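(* For $C>0$ sufficiently small (i.e. there exists $C_0>0$ such that for all $0<C\le C_0$), $$\mathbb{P}\left(\exists\, \tau\in[0,1] \text{ such that } \limsup_{t\to\infty}\frac{S_0^{\tau}(t)}{\sqrt{t\log(t)}}\ge C \ \text{ and }\ \liminf_{t\to\infty}\frac{S_0^{\tau}(t)}{\sqrt{t\log(t)}}\le -C\right)=1 .$$
   Context: Dynamical discrete web (DyDW): let $\mathbb{Z}^2_{\mathrm{even}}=\{(x,t)\in\mathbb{Z}^2: x+t \text{ even}\}$, where $x$ is space and $t$ is (random walk) time. To each $z\in\mathbb{Z}^2_{\mathrm{even}}$ assign, independently over $z$, a right-continuous process $(\xi_z^\tau)_{\tau\ge 0}$ with values in $\{-1,+1\}$: $\xi_z^0$ is uniform on $\{\pm1\}$, and at each ring of a rate one Poisson clock attached to $z$ the value is replaced by a fresh independent uniform $\pm1$ variable (which may agree with the old value). All clocks, initial values and resampled values are independent. The parameter $\tau$ is called dynamical time. For fixed $\tau$, draw an arrow from each $(x,t)\in\mathbb{Z}^2_{\mathrm{even}}$ to $(x+\xi_{(x,t)}^\tau,t+1)$; $S_{z}^{\tau}(\cdot)$ denotes the path that starts at $z$ and follows the arrows at dynamical time $\tau$ (linearly interpolated between integer times). $S_0^\tau:=S_{(0,0)}^\tau$ is the path from the origin. *)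

theory Defs
  imports "HOL-Probability.Probability"
begin

text \<open>A site is a pair of a space coordinate and a (random walk) time coordinate.\<close>

definition even_lattice :: "(int \<times> int) set" where
  "even_lattice = {(x, t). even (x + t)}"

text \<open>
  The process at one site is a function of the gaps \<open>g\<close> between successive rings of its
  clock and of the successive values \<open>s\<close>: \<open>s 0\<close> is the initial value and \<open>s (Suc n)\<close> is the
  fresh value drawn at the ring with index \<open>n\<close> (rings are indexed from \<open>0\<close>).
\<close>

definition ring_time :: "(nat \<Rightarrow> real) \<Rightarrow> nat \<Rightarrow> real" where
  "ring_time g n = (\<Sum>i\<le>n. g i)"

text \<open>
  Counting the rings up to and including \<open>\<tau>\<close> makes the process right-continuous. When rings
  accumulate, \<open>card\<close> may return a meaningless \<open>0\<close>; for exponential gaps this has probability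
  zero.
\<close>

definition ring_count :: "(nat \<Rightarrow> real) \<Rightarrow> real \<Rightarrow> nat" where
  "ring_count g \<tau> = card {n. ring_time g n \<le> \<tau>}"

definition site_value :: "(nat \<Rightarrow> real) \<Rightarrow> (nat \<Rightarrow> int) \<Rightarrow> real \<Rightarrow> int" where
  "site_value g s \<tau> = s (ring_count g \<tau>)"

text \<open>
  A Poisson clock of rate one is given by independent exponential gaps. The joint independence
  assumption covers all gaps and all drawn values at all sites; the values are embedded into the
  reals there because \<open>indep_vars\<close> needs a common range type.
\<close>

locale dynamical_web = prob_space M for M :: "'a measure" +
  fixes gap :: "int \<times> int \<Rightarrow> nat \<Rightarrow> 'a \<Rightarrow> real"
    and spin :: "int \<times> int \<Rightarrow> nat \<Rightarrow> 'a \<Rightarrow> int"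
    and \<xi> :: "int \<times> int \<Rightarrow> real \<Rightarrow> 'a \<Rightarrow> int"
  assumes gap_exponential:
      "z \<in> even_lattice \<Longrightarrow> distributed M lborel (gap z n) (exponential_density 1)"
    and spin_values:
      "z \<in> even_lattice \<Longrightarrow> \<omega> \<in> space M \<Longrightarrow> spin z n \<omega> \<in> {-1, 1}"
    and spin_uniform:
      "z \<in> even_lattice \<Longrightarrow> v \<in> {-1, 1} \<Longrightarrow> prob {\<omega> \<in> space M. spin z n \<omega> = v} = 1 / 2"
    and gap_spin_indep:
      "indep_vars (\<lambda>_. borel)
         (case_sum (\<lambda>(z, n) \<omega>. gap z n \<omega>) (\<lambda>(z, n) \<omega>. real_of_int (spin z n \<omega>)))
         ((even_lattice \<times> UNIV) <+> (even_lattice \<times> UNIV))"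
    and \<xi>_eq:
      "z \<in> even_lattice \<Longrightarrow> \<tau> \<ge> 0 \<Longrightarrow> \<omega> \<in> space M \<Longrightarrow>
         \<xi> z \<tau> \<omega> = site_value (\<lambda>n. gap z n \<omega>) (\<lambda>n. spin z n \<omega>) \<tau>"

text \<open>The assumptions are consistent: the web lives on an infinite product space.\<close>

lemma dynamical_web_exists:
  "\<exists>(M :: ((int \<times> int) \<times> nat + (int \<times> int) \<times> nat \<Rightarrow> real) measure) gap spin \<xi>.
     dynamical_web M gap spin \<xi>"
proof -
  define N :: "(int \<times> int) \<times> nat + (int \<times> int) \<times> nat \<Rightarrow> real measure" where
    "N = case_sum (\<lambda>_. density lborel (exponential_density 1))
                  (\<lambda>_. distr (measure_pmf (pmf_of_set {-1, 1 :: real})) borel id)"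
  define M where "M = PiM UNIV N"
  define gap where "gap z n \<omega> = \<omega> (Inl (z, n))"
    for z n and \<omega> :: "(int \<times> int) \<times> nat + (int \<times> int) \<times> nat \<Rightarrow> real"
  define spin :: "int \<times> int \<Rightarrow> nat \<Rightarrow> ((int \<times> int) \<times> nat + (int \<times> int) \<times> nat \<Rightarrow> real) \<Rightarrow> int"
    where "spin z n \<omega> = (if \<omega> (Inr (z, n)) = 1 then 1 else -1)" for z n \<omega>
  define \<xi> where "\<xi> z \<tau> \<omega> = site_value (\<lambda>n. gap z n \<omega>) (\<lambda>n. spin z n \<omega>) \<tau>" for z \<tau> \<omega>
  have prob_N: "prob_space (N i)" for i
  proof (cases i)
    case Inl
    then show ?thesis by (simp add: N_def prob_space_exponential_density)
  next
    case Inr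
    then show ?thesis
      by (auto simp: N_def intro!: prob_space.prob_space_distr measure_pmf.prob_space_axioms)
  qed
  have sets_N [measurable_cong]: "sets (N i) = sets borel" for i
    by (cases i) (simp_all add: N_def)
  interpret product_prob_space N UNIV
    by (rule product_prob_spaceI) (rule prob_N)
  interpret Q: prob_space M
    unfolding M_def by (rule prob_space_PiM) (rule prob_N)
  have coord: "distr M (N i) (\<lambda>\<omega>. \<omega> i) = N i" for i
    unfolding M_def by (rule PiM_component) simp
  have coord_borel: "(\<lambda>\<omega>. \<omega> i) \<in> borel_measurable M" for i
    using measurable_component_singleton[of i UNIV N] unfolding M_def
    by (simp add: measurable_cong_sets[OF refl sets_N])
  have distr_M: "distr M borel (\<lambda>\<omega>. \<omega> i) = N i" for i
    using coord[of i] by (metis distr_cong sets_N)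
  have "Q.indep_vars N (\<lambda>i \<omega>. \<omega> i) UNIV"
  proof (subst Q.indep_vars_iff_distr_eq_PiM)
    have "distr M (PiM UNIV N) (\<lambda>x. \<lambda>i\<in>UNIV. x i) = distr M M (\<lambda>x. x)"
      by (simp add: M_def restrict_def)
    then show "distr M (PiM UNIV N) (\<lambda>x. \<lambda>i\<in>UNIV. x i) =
        PiM UNIV (\<lambda>i. distr M (N i) (\<lambda>\<omega>. \<omega> i))"
      unfolding coord by (simp add: M_def[symmetric])
  qed (simp_all add: M_def)
  then have "Q.indep_vars (\<lambda>_. borel)
      (\<lambda>i \<omega>. case i of Inl _ \<Rightarrow> \<omega> i | Inr _ \<Rightarrow> if \<omega> i = 1 then 1 else -1) UNIV"
  proof (rule Q.indep_vars_compose2)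
    show "(\<lambda>x. case i of Inl _ \<Rightarrow> x | Inr _ \<Rightarrow> if x = 1 then 1 else -1) \<in> borel_measurable (N i)" for i
      by (cases i) (simp_all add: measurable_cong_sets[OF sets_N refl])
  qed
  then have indep: "Q.indep_vars (\<lambda>_. borel)
      (case_sum (\<lambda>(z, n) \<omega>. gap z n \<omega>) (\<lambda>(z, n) \<omega>. real_of_int (spin z n \<omega>)))
      ((even_lattice \<times> UNIV) <+> (even_lattice \<times> UNIV))"
    by (rule Q.indep_vars_cong[THEN iffD1, rotated -1, OF Q.indep_vars_subset])
       (auto simp: gap_def spin_def fun_eq_iff split: sum.split)
  have spin_one: "Q.prob {\<omega> \<in> space M. \<omega> (Inr (z, n)) \<in> A} = measure_pmf.prob (pmf_of_set {-1, 1}) A"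
    if "A \<in> sets borel" for z n A
  proof -
    have "measure (N (Inr (z, n))) A = Q.prob ((\<lambda>\<omega>. \<omega> (Inr (z, n))) -` A \<inter> space M)"
      unfolding distr_M[symmetric] by (rule measure_distr) (use coord_borel that in auto)
    moreover have "measure (N (Inr (z, n))) A = measure_pmf.prob (pmf_of_set {-1, 1}) A"
      unfolding N_def using that by (simp add: measure_distr)
    ultimately show ?thesis by (simp add: vimage_def Int_def conj_commute)
  qed
  have "space (N i) = UNIV" for i
    using sets_eq_imp_space_eq[OF sets_N[of i]] by simp
  then have [simp]: "space M = UNIV"
    by (simp add: M_def space_PiM)
  have "dynamical_web M gap spin \<xi>"
  proof
    show "distributed M lborel (gap z n) (exponential_density 1)" for z n
      unfolding distributed_def gap_def
      using coord_borel[of "Inl (z, n)"] distr_M[of "Inl (z, n)"]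
        distr_cong[of M M lborel borel "\<lambda>\<omega>. \<omega> (Inl (z, n))" "\<lambda>\<omega>. \<omega> (Inl (z, n))"]
      by (simp add: N_def)
    show "Q.prob {\<omega> \<in> space M. spin z n \<omega> = v} = 1 / 2" if "v \<in> {-1, 1}" for z n v
      using that spin_one[of "{1}" z n] spin_one[of "-{1}" z n]
      by (auto simp: spin_def measure_pmf_of_set)
    show "spin z n \<omega> \<in> {-1, 1}" for z n \<omega>
      by (simp add: spin_def)
  qed (simp_all add: \<xi>_def indep)
  then show ?thesis by blast
qed

text \<open>\<open>a z\<close> is the horizontal displacement along the arrow that leaves \<open>z\<close>.\<close>

primrec follow_arrows :: "(int \<times> int \<Rightarrow> int) \<Rightarrow> int \<times> int \<Rightarrow> nat \<Rightarrow> int \<times> int" where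
  "follow_arrows a z 0 = z"
| "follow_arrows a z (Suc k) =
     (case follow_arrows a z k of (x, t) \<Rightarrow> (x + a (x, t), t + 1))"

text \<open>Linear interpolation between integer times; only meaningful for \<open>t \<ge> snd z\<close>.\<close>

definition web_path :: "(int \<times> int \<Rightarrow> int) \<Rightarrow> int \<times> int \<Rightarrow> real \<Rightarrow> real" where
  "web_path a z t =
     (let u = t - real_of_int (snd z);
          k = nat \<lfloor>u\<rfloor>
      in (1 - frac u) * real_of_int (fst (follow_arrows a z k))
         + frac u * real_of_int (fst (follow_arrows a z (Suc k))))"

end

theory Submission
  imports Defs "HOL-Real_Asymp.Real_Asymp"
begin

text \<open>
  For a fixed dynamical time the path is a simple random walk. Take \<open>n = m ^ 4\<close>, let
  \<open>\<tau>\<^sub>1, \<dots>, \<tau>\<^sub>m\<close> be equally spaced dynamical times in a given interval, and let \<open>Z\<close> be the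
  average over \<open>i\<close> of the mean-one variables \<open>exp (l * S\<^sub>i) / cosh l ^ n\<close>, where \<open>S\<^sub>i\<close> is the
  position of the path at time \<open>n\<close> and dynamical time \<open>\<tau>\<^sub>i\<close> and \<open>l\<close> is of order \<open>sqrt (ln n / n)\<close>.
  Walks at different dynamical times interact only where they meet, and they separate again at a
  rate proportional to the difference of the dynamical times; a barrier function of their distance
  then shows that the variance of \<open>Z\<close> tends to \<open>0\<close>. As the largest term is at least the average,
  with probability tending to \<open>1\<close> some \<open>i\<close> has \<open>exp (l * S\<^sub>i) \<ge> cosh l ^ n / 2\<close>, so that \<open>S\<^sub>i\<close> is
  of order \<open>sqrt (n * ln n)\<close>; a negative \<open>l\<close> gives large negative values.

  The path up to a finite time is constant on a dynamical interval to the right of each \<open>\<tau>\<close>.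
  Hence almost surely, for each sign and each \<open>N\<close>, the set of \<open>\<tau>\<close> at which the path is large for
  some \<open>m \<ge> N\<close> contains a dense open set, and by Baire's theorem these countably many sets have a
  common point.
\<close>

subsection \<open>Two coupled families of arrows\<close>

lemma measurable_count_space_Pair:
  fixes f :: "'b \<Rightarrow> 'c :: countable" and g :: "'b \<Rightarrow> 'd :: countable"
  assumes "f \<in> measurable N (count_space UNIV)" "g \<in> measurable N (count_space UNIV)"
  shows "(\<lambda>x. (f x, g x)) \<in> measurable N (count_space UNIV)"
  using measurable_Pair[OF assms] by (simp add: pair_measure_countable)

text \<open>Agreement is demanded only at the sites that the path of \<open>a\<close> actually
  visits before step \<open>k\<close>. This makes it possible to change the arrows anywhere else:
  outside the past, off the lattice, or at another dynamical time.\<close>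

lemma follow_arrows_cong:
  assumes "\<And>j. j < k \<Longrightarrow> a (follow_arrows a z j) = b (follow_arrows a z j)"
  shows "follow_arrows a z k = follow_arrows b z k"
  using assms
proof (induction k)
  case (Suc k)
  have "follow_arrows a z k = follow_arrows b z k"
    using Suc by simp
  then show ?case
    using Suc.prems[of k] by (cases "follow_arrows b z k") simp
qed simp

lemma follow_arrows_lattice:
  assumes "\<And>z. z \<in> even_lattice \<Longrightarrow> a z \<in> {-1, 1}"
  shows "follow_arrows a (0, 0) k \<in> even_lattice"
    and "snd (follow_arrows a (0, 0) k) = int k"
    and "\<bar>fst (follow_arrows a (0, 0) k)\<bar> \<le> int k"
proof -
  have "follow_arrows a (0, 0) k \<in> even_lattice \<and> snd (follow_arrows a (0, 0) k) = int k \<and>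
    \<bar>fst (follow_arrows a (0, 0) k)\<bar> \<le> int k"
  proof (induction k)
    case (Suc k)
    obtain x t where xt: "follow_arrows a (0, 0) k = (x, t)"
      by fastforce
    with Suc assms[of "(x, t)"] show ?case
      by (auto simp: even_lattice_def)
  qed (simp add: even_lattice_def)
  then show "follow_arrows a (0, 0) k \<in> even_lattice"
    and "snd (follow_arrows a (0, 0) k) = int k"
    and "\<bar>fst (follow_arrows a (0, 0) k)\<bar> \<le> int k"
    by auto
qed

text \<open>Sites outside \<open>K\<close> receive the default arrow \<open>c (0, 0)\<close>, since
  a point of the product over \<open>K\<close> carries no information there. The next arrow is read
  at a random site; as there are only countably many sites, measurability for each fixed site
  suffices.\<close>

lemma measurable_follow_arrows:
  fixes c :: "int \<times> int \<Rightarrow> int"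
  shows "(\<lambda>f. follow_arrows (\<lambda>z. c (if z \<in> K then f z else (0, 0))) z0 k)
    \<in> measurable (PiM K (\<lambda>_. count_space UNIV)) (count_space UNIV)"
proof (induction k)
  case 0
  show ?case
    by (simp only: follow_arrows.simps measurable_const space_count_space UNIV_I)
next
  case (Suc k)
  let ?M = "PiM K (\<lambda>_. count_space UNIV) :: (int \<times> int \<Rightarrow> int \<times> int) measure"
  let ?g = "\<lambda>f. follow_arrows (\<lambda>z. c (if z \<in> K then f z else (0, 0))) z0 k"
  define step where "step p f = (fst p + c (if p \<in> K then f p else (0, 0)), snd p + 1)"
    for p and f :: "int \<times> int \<Rightarrow> int \<times> int"
  have "step p \<in> measurable ?M (count_space UNIV)" for p
  proof (cases "p \<in> K")
    case True
    then have "(\<lambda>f. f p) \<in> measurable ?M (count_space UNIV)"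
      by (rule measurable_component_singleton)
    from measurable_comp[OF this, of "\<lambda>v. (fst p + c v, snd p + 1)" "count_space UNIV"] True
    show ?thesis
      by (simp add: step_def comp_def cong: measurable_cong_simp)
  next
    case False
    then have "step p = (\<lambda>_. (fst p + c (0, 0), snd p + 1))"
      by (simp add: step_def fun_eq_iff)
    then show ?thesis
      by simp
  qed
  from measurable_compose_countable[where f = step and g = ?g, OF this Suc]
  show ?case
    by (simp only: follow_arrows.simps step_def case_prod_beta prod.collapse)
qed

text \<open>The first components drive one walk and the second components another. Independence is
  between sites only; the joint law of the two components at one site is left open here.\<close>

locale arrow_pairs = prob_space M for M :: "'a measure" +
  fixes Y :: "int \<times> int \<Rightarrow> 'a \<Rightarrow> int \<times> int"
  assumes indep_sites: "indep_vars (\<lambda>_. count_space UNIV) Y even_lattice"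
    and Y_values: "z \<in> even_lattice \<Longrightarrow> \<omega> \<in> space M \<Longrightarrow> Y z \<omega> \<in> {-1, 1} \<times> {-1, 1}"
begin

lemma measurable_Y: "z \<in> even_lattice \<Longrightarrow> Y z \<in> measurable M (count_space UNIV)"
  using indep_sites by (auto simp: indep_vars_def)

definition walk1 where "walk1 n \<omega> = fst (follow_arrows (\<lambda>z. fst (Y z \<omega>)) (0, 0) n)"
definition walk2 where "walk2 n \<omega> = fst (follow_arrows (\<lambda>z. snd (Y z \<omega>)) (0, 0) n)"

lemma Y_components:
  assumes "z \<in> even_lattice" "\<omega> \<in> space M"
  shows "fst (Y z \<omega>) \<in> {-1, 1}" "snd (Y z \<omega>) \<in> {-1, 1}"
  using Y_values[OF assms] by (simp_all only: mem_Times_iff)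

lemma walk_point:
  assumes "\<omega> \<in> space M"
  shows "follow_arrows (\<lambda>z. fst (Y z \<omega>)) (0, 0) n = (walk1 n \<omega>, int n)"
    and "follow_arrows (\<lambda>z. snd (Y z \<omega>)) (0, 0) n = (walk2 n \<omega>, int n)"
  using follow_arrows_lattice(2)[of "\<lambda>z. fst (Y z \<omega>)" n, OF Y_components(1)[OF _ assms]]
    follow_arrows_lattice(2)[of "\<lambda>z. snd (Y z \<omega>)" n, OF Y_components(2)[OF _ assms]]
  by (simp_all add: walk1_def walk2_def prod_eq_iff)

lemma walk_lattice:
  assumes "\<omega> \<in> space M"
  shows "(walk1 n \<omega>, int n) \<in> even_lattice" "(walk2 n \<omega>, int n) \<in> even_lattice"
    and "\<bar>walk1 n \<omega>\<bar> \<le> int n" "\<bar>walk2 n \<omega>\<bar> \<le> int n"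
  using follow_arrows_lattice(1,3)[of "\<lambda>z. fst (Y z \<omega>)" n, OF Y_components(1)[OF _ assms]]
    follow_arrows_lattice(1,3)[of "\<lambda>z. snd (Y z \<omega>)" n, OF Y_components(2)[OF _ assms]]
  by (simp_all add: walk_point[OF assms])

lemma walk_Suc:
  assumes "\<omega> \<in> space M"
  shows "walk1 (Suc n) \<omega> = walk1 n \<omega> + fst (Y (walk1 n \<omega>, int n) \<omega>)"
    and "walk2 (Suc n) \<omega> = walk2 n \<omega> + snd (Y (walk2 n \<omega>, int n) \<omega>)"
  using walk_point[OF assms, of n]
  by (simp_all add: walk1_def[of "Suc n"] walk2_def[of "Suc n"])

lemma walk_zero [simp]: "walk1 0 \<omega> = 0" "walk2 0 \<omega> = 0"
  by (simp_all add: walk1_def walk2_def)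

definition past :: "nat \<Rightarrow> (int \<times> int) set" where
  "past n = {z \<in> even_lattice. snd z < int n}"

text \<open>The position at time \<open>n\<close> as a function of the arrows at earlier times
  alone. In this form it is seen to be independent of the arrows that leave the sites of time
  \<open>n\<close>.\<close>

definition walk_of :: "(int \<times> int \<Rightarrow> int) \<Rightarrow> nat \<Rightarrow> (int \<times> int \<Rightarrow> int \<times> int) \<Rightarrow> int" where
  "walk_of c n f = fst (follow_arrows (\<lambda>z. c (if z \<in> past n then f z else (0, 0))) (0, 0) n)"

lemma walk_of_eq:
  assumes "\<omega> \<in> space M"
  shows "walk1 n \<omega> = walk_of fst n (restrict (\<lambda>z. Y z \<omega>) (past n))"
    and "walk2 n \<omega> = walk_of snd n (restrict (\<lambda>z. Y z \<omega>) (past n))"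
proof -
  have *: "follow_arrows (\<lambda>z. c (Y z \<omega>)) (0, 0) n =
     follow_arrows (\<lambda>z. c (if z \<in> past n then restrict (\<lambda>z. Y z \<omega>) (past n) z else (0, 0))) (0, 0) n"
    if "\<And>z. z \<in> even_lattice \<Longrightarrow> c (Y z \<omega>) \<in> {-1, 1}" for c :: "int \<times> int \<Rightarrow> int"
  proof (rule follow_arrows_cong)
    fix j assume "j < n"
    then have "follow_arrows (\<lambda>z. c (Y z \<omega>)) (0, 0) j \<in> past n"
      using follow_arrows_lattice[of "\<lambda>z. c (Y z \<omega>)" j] that by (simp add: past_def)
    then show "c (Y (follow_arrows (\<lambda>z. c (Y z \<omega>)) (0, 0) j) \<omega>) =
      c (if follow_arrows (\<lambda>z. c (Y z \<omega>)) (0, 0) j \<in> past n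
         then restrict (\<lambda>z. Y z \<omega>) (past n) (follow_arrows (\<lambda>z. c (Y z \<omega>)) (0, 0) j) else (0, 0))"
      by simp
  qed
  show "walk1 n \<omega> = walk_of fst n (restrict (\<lambda>z. Y z \<omega>) (past n))"
    unfolding walk1_def walk_of_def using *[of fst, OF Y_components(1)[OF _ assms]] by simp
  show "walk2 n \<omega> = walk_of snd n (restrict (\<lambda>z. Y z \<omega>) (past n))"
    unfolding walk2_def walk_of_def using *[of snd, OF Y_components(2)[OF _ assms]] by simp
qed

lemma measurable_walk_of:
  "walk_of c n \<in> measurable (PiM (past n) (\<lambda>_. count_space UNIV)) (count_space UNIV)"
proof -
  have "walk_of c n = fst \<circ> (\<lambda>f. follow_arrows (\<lambda>z. c (if z \<in> past n then f z else (0, 0))) (0, 0) n)"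
    by (simp add: walk_of_def fun_eq_iff)
  then show ?thesis
    using measurable_comp[OF measurable_follow_arrows, of fst "count_space UNIV" c "past n" "(0, 0)" n]
    by simp
qed

lemma measurable_restrict_Y:
  assumes "K \<subseteq> even_lattice"
  shows "(\<lambda>\<omega>. restrict (\<lambda>z. Y z \<omega>) K) \<in> measurable M (PiM K (\<lambda>_. count_space UNIV))"
proof (rule measurable_restrict)
  show "Y z \<in> measurable M (count_space UNIV)" if "z \<in> K" for z
    using that assms by (intro measurable_Y) auto
qed

lemma measurable_walk [measurable]:
  "walk1 n \<in> measurable M (count_space UNIV)" "walk2 n \<in> measurable M (count_space UNIV)"
proof -
  have past: "past n \<subseteq> even_lattice"
    by (auto simp: past_def)
  have *: "(\<lambda>\<omega>. walk_of c n (restrict (\<lambda>z. Y z \<omega>) (past n))) \<in> measurable M (count_space UNIV)" for c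
    using measurable_compose[OF measurable_restrict_Y[OF past] measurable_walk_of[of c n]] .
  show "walk1 n \<in> measurable M (count_space UNIV)"
    using *[of fst] measurable_cong[of M "walk1 n", OF walk_of_eq(1)] by simp
  show "walk2 n \<in> measurable M (count_space UNIV)"
    using *[of snd] measurable_cong[of M "walk2 n", OF walk_of_eq(2)] by simp
qed

text \<open>After \<open>n\<close> steps both walks lie in a finite box, so every \<open>H\<close>
  is bounded along them.\<close>

lemma bounded_walk_integrable:
  fixes H :: "int \<Rightarrow> int \<Rightarrow> real"
  shows "integrable M (\<lambda>\<omega>. H (walk1 n \<omega>) (walk2 n \<omega>))"
proof -
  let ?J = "{- int n..int n}"
  let ?B = "\<Sum>x\<in>?J. \<Sum>y\<in>?J. \<bar>H x y\<bar>"
  have "\<bar>H (walk1 n \<omega>) (walk2 n \<omega>)\<bar> \<le> ?B" if "\<omega> \<in> space M" for \<omega>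
  proof -
    have J: "walk1 n \<omega> \<in> ?J" "walk2 n \<omega> \<in> ?J"
      using walk_lattice(3,4)[OF that, of n] by auto
    have "\<bar>H (walk1 n \<omega>) (walk2 n \<omega>)\<bar> \<le> (\<Sum>y\<in>?J. \<bar>H (walk1 n \<omega>) y\<bar>)"
      using J by (intro member_le_sum) auto
    also have "\<dots> \<le> ?B"
      using J by (intro member_le_sum[where f = "\<lambda>x. \<Sum>y\<in>?J. \<bar>H x y\<bar>"]) (auto intro: sum_nonneg)
    finally show ?thesis .
  qed
  then show ?thesis
    by (intro integrable_const_bound[where B = ?B] AE_I2) auto
qed

text \<open>The Markov property of the pair of walks. The event that the walks are at
  \<open>x\<close> and \<open>y\<close> depends on the past, the next two arrows on sites of time
  \<open>n\<close>, so the expectations factorise for each \<open>(x, y)\<close>; summing over all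
  positions puts them together again. The inner expectation is over a fresh sample.\<close>

lemma expectation_step:
  fixes H :: "int \<Rightarrow> int \<Rightarrow> real"
  shows "expectation (\<lambda>\<omega>. H (walk1 (Suc n) \<omega>) (walk2 (Suc n) \<omega>)) =
    expectation (\<lambda>\<omega>. (\<lambda>x y. expectation (\<lambda>\<omega>'. H (x + fst (Y (x, int n) \<omega>')) (y + snd (Y (y, int n) \<omega>'))))
      (walk1 n \<omega>) (walk2 n \<omega>))"
proof -
  \<comment> \<open>The parity restriction keeps all sites in the lattice, where independence and
    the values of \<open>Y\<close> are known.\<close>
  define J where "J = {x \<in> {- int n..int n}. (x, int n) \<in> even_lattice}"
  have fin: "finite J"
    by (rule finite_subset[of _ "{- int n..int n}"]) (auto simp: J_def)
  have inJ: "walk1 n \<omega> \<in> J" "walk2 n \<omega> \<in> J" if "\<omega> \<in> space M" for \<omega>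
    using walk_lattice[OF that, of n] by (auto simp: J_def)
  define fU :: "int \<Rightarrow> int \<Rightarrow> (int \<times> int \<Rightarrow> int \<times> int) \<Rightarrow> real"
    where "fU x y f = of_bool (walk_of fst n f = x \<and> walk_of snd n f = y)" for x y f
  define U where "U x y = fU x y \<circ> (\<lambda>\<omega>. restrict (\<lambda>z. Y z \<omega>) (past n))" for x y
  have U_eq: "U x y \<omega> = of_bool (walk1 n \<omega> = x \<and> walk2 n \<omega> = y)" if "\<omega> \<in> space M" for x y \<omega>
    by (simp add: U_def fU_def walk_of_eq[OF that])
  define V where "V x y \<omega> = H (x + fst (Y (x, int n) \<omega>)) (y + snd (Y (y, int n) \<omega>))" for x y \<omega>
  \<comment> \<open>Exactly one term survives. This is used twice: first with the random
    \<open>V\<close> in place of \<open>F\<close>, then with its expectation.\<close>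
  have pick: "(\<Sum>x\<in>J. \<Sum>y\<in>J. U x y \<omega> * F x y) = F (walk1 n \<omega>) (walk2 n \<omega>)"
    if "\<omega> \<in> space M" for \<omega> and F :: "int \<Rightarrow> int \<Rightarrow> real"
  proof -
    have "(\<Sum>x\<in>J. \<Sum>y\<in>J. U x y \<omega> * F x y) =
        (\<Sum>x\<in>J. \<Sum>y\<in>J. if walk1 n \<omega> = x then if walk2 n \<omega> = y then F x y else 0 else 0)"
      using U_eq[OF that] by (intro sum.cong) auto
    also have "\<dots> = (\<Sum>x\<in>J. if walk1 n \<omega> = x then F x (walk2 n \<omega>) else 0)"
      using fin inJ(2)[OF that] by (intro sum.cong) (auto simp: sum.delta)
    finally show ?thesis
      using fin inJ(1)[OF that] by (simp add: sum.delta)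
  qed
  have indep: "indep_var borel (U x y) borel (V x y)" if "x \<in> J" "y \<in> J" for x y
  proof -
    \<comment> \<open>The set has one element when the walks meet, so meeting and separated walks
      are treated alike.\<close>
    let ?K = "{(x, int n), (y, int n)}"
    have K: "?K \<subseteq> even_lattice" "past n \<subseteq> even_lattice" "past n \<inter> ?K = {}"
      using that by (auto simp: past_def J_def)
    have I: "indep_var (PiM (past n) (\<lambda>_. count_space UNIV)) (\<lambda>\<omega>. restrict (\<lambda>z. Y z \<omega>) (past n))
        (PiM ?K (\<lambda>_. count_space UNIV)) (\<lambda>\<omega>. restrict (\<lambda>z. Y z \<omega>) ?K)"
      by (rule indep_var_restrict[OF indep_sites K(3,2,1)])
    define fV :: "(int \<times> int \<Rightarrow> int \<times> int) \<Rightarrow> real"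
      where "fV f = H (x + fst (f (x, int n))) (y + snd (f (y, int n)))" for f
    have "fU x y \<in> borel_measurable (PiM (past n) (\<lambda>_. count_space UNIV))"
      using measurable_walk_of[of fst n] measurable_walk_of[of snd n]
      unfolding fU_def by measurable
    moreover have "fV \<in> borel_measurable (PiM ?K (\<lambda>_. count_space UNIV))"
    proof -
      have [measurable]: "(\<lambda>f. f z) \<in> measurable (PiM ?K (\<lambda>_. count_space UNIV)) (count_space UNIV)"
        if "z \<in> ?K" for z
        using that by (intro measurable_component_singleton)
      have "(\<lambda>f. (f (x, int n), f (y, int n))) \<in> measurable (PiM ?K (\<lambda>_. count_space UNIV))
          (count_space UNIV \<Otimes>\<^sub>M count_space UNIV :: ((int \<times> int) \<times> (int \<times> int)) measure)"
        by measurable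
      then have *: "(\<lambda>f. (f (x, int n), f (y, int n))) \<in> measurable (PiM ?K (\<lambda>_. count_space UNIV))
          (count_space UNIV :: ((int \<times> int) \<times> (int \<times> int)) measure)"
        by (simp add: pair_measure_countable)
      show ?thesis
        using measurable_comp[OF *, of "\<lambda>p. H (x + fst (fst p)) (y + snd (snd p))" borel]
        by (simp add: fV_def[abs_def] comp_def)
    qed
    ultimately have "indep_var borel (fU x y \<circ> (\<lambda>\<omega>. restrict (\<lambda>z. Y z \<omega>) (past n)))
        borel (fV \<circ> (\<lambda>\<omega>. restrict (\<lambda>z. Y z \<omega>) ?K))"
      by (rule indep_var_compose[OF I])
    moreover have "V x y = fV \<circ> (\<lambda>\<omega>. restrict (\<lambda>z. Y z \<omega>) ?K)"
      by (simp add: V_def fV_def fun_eq_iff)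
    ultimately show ?thesis
      by (simp only: U_def)
  qed
  have intU: "integrable M (U x y)" for x y
    using bounded_walk_integrable[of "\<lambda>u v. of_bool (u = x \<and> v = y)" n]
    by (rule Bochner_Integration.integrable_cong[THEN iffD1, OF refl, rotated]) (simp add: U_eq)
  have V_bounded: "\<bar>V x y \<omega>\<bar> \<le> (\<Sum>u\<in>{-1, 1}. \<Sum>v\<in>{-1, 1}. \<bar>H (x + u) (y + v)\<bar>)"
    if "\<omega> \<in> space M" "x \<in> J" "y \<in> J" for x y \<omega>
    using Y_components(1)[of "(x, int n)", OF _ that(1)] Y_components(2)[of "(y, int n)", OF _ that(1)]
      that(2,3)
    by (auto simp: V_def J_def)
  have intV: "integrable M (V x y)" if "x \<in> J" "y \<in> J" for x y
    using V_bounded[OF _ that] indep[OF that]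
    by (intro integrable_const_bound[OF AE_I2]) (auto simp: indep_var_eq)
  have intUV: "integrable M (\<lambda>\<omega>. U x y \<omega> * V x y \<omega>)" if "x \<in> J" "y \<in> J" for x y
    by (rule indep_var_integrable[OF indep[OF that] intU intV[OF that]])
  have "expectation (\<lambda>\<omega>. H (walk1 (Suc n) \<omega>) (walk2 (Suc n) \<omega>)) =
      expectation (\<lambda>\<omega>. \<Sum>x\<in>J. \<Sum>y\<in>J. U x y \<omega> * V x y \<omega>)"
  proof (intro Bochner_Integration.integral_cong refl)
    show "H (walk1 (Suc n) \<omega>) (walk2 (Suc n) \<omega>) = (\<Sum>x\<in>J. \<Sum>y\<in>J. U x y \<omega> * V x y \<omega>)"
      if "\<omega> \<in> space M" for \<omega>
      unfolding pick[of \<omega> "\<lambda>x y. V x y \<omega>", OF that] by (simp add: walk_Suc[OF that] V_def)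
  qed
  also have "\<dots> = (\<Sum>x\<in>J. \<Sum>y\<in>J. expectation (\<lambda>\<omega>. U x y \<omega> * V x y \<omega>))"
    by (simp add: Bochner_Integration.integral_sum Bochner_Integration.integrable_sum intUV)
  also have "\<dots> = (\<Sum>x\<in>J. \<Sum>y\<in>J. expectation (U x y) * expectation (V x y))"
    using indep intU intV by (intro sum.cong refl indep_var_lebesgue_integral) auto
  also have "\<dots> = expectation (\<lambda>\<omega>. \<Sum>x\<in>J. \<Sum>y\<in>J. U x y \<omega> * expectation (V x y))"
    by (simp add: Bochner_Integration.integral_sum Bochner_Integration.integrable_sum intU)
  also have "\<dots> = expectation (\<lambda>\<omega>. expectation (V (walk1 n \<omega>) (walk2 n \<omega>)))"
    by (intro Bochner_Integration.integral_cong refl) (simp add: pick[of _ "\<lambda>x y. expectation (V x y)"])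
  finally show ?thesis
    by (simp add: V_def[abs_def])
qed

end

section \<open>Exponential moments of two correlated walks\<close>

lemma (in prob_space) expectation_pair_of_signs:
  fixes X X' :: "'a \<Rightarrow> int" and G :: "int \<Rightarrow> int \<Rightarrow> real"
  assumes [measurable]: "X \<in> measurable M (count_space UNIV)" "X' \<in> measurable M (count_space UNIV)"
    and signs: "\<And>\<omega>. \<omega> \<in> space M \<Longrightarrow> X \<omega> \<in> {-1, 1} \<and> X' \<omega> \<in> {-1, 1}"
  shows "expectation (\<lambda>\<omega>. G (X \<omega>) (X' \<omega>)) =
    (\<Sum>u\<in>{-1, 1}. \<Sum>v\<in>{-1, 1}. prob {\<omega> \<in> space M. X \<omega> = u \<and> X' \<omega> = v} * G u v)"
proof -
  let ?A = "\<lambda>u v. {\<omega> \<in> space M. X \<omega> = u \<and> X' \<omega> = v}"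
  have "expectation (\<lambda>\<omega>. G (X \<omega>) (X' \<omega>)) =
      expectation (\<lambda>\<omega>. \<Sum>u\<in>{-1, 1}. \<Sum>v\<in>{-1, 1}. indicator (?A u v) \<omega> * G u v)"
  proof (intro Bochner_Integration.integral_cong refl)
    show "G (X \<omega>) (X' \<omega>) = (\<Sum>u\<in>{-1, 1}. \<Sum>v\<in>{-1, 1}. indicator (?A u v) \<omega> * G u v)"
      if "\<omega> \<in> space M" for \<omega>
    proof -
      have pair: "(\<Sum>u\<in>{-1, 1}. f u) = f (-1) + f 1" for f :: "int \<Rightarrow> real"
        by simp
      show ?thesis
        unfolding pair using signs[OF that] that by (elim conjE insertE emptyE) simp_all
    qed
  qed
  also have "\<dots> = (\<Sum>u\<in>{-1, 1}. \<Sum>v\<in>{-1, 1}. expectation (\<lambda>\<omega>. indicator (?A u v) \<omega> * G u v))"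
  proof -
    have "integrable M (\<lambda>\<omega>. indicator (?A u v) \<omega> * G u v)" for u v
      by (intro integrable_mult_left integrable_real_indicator) (auto simp: less_top[symmetric])
    then show ?thesis
      by (simp only: Bochner_Integration.integral_sum Bochner_Integration.integrable_sum)
  qed
  also have "\<dots> = (\<Sum>u\<in>{-1, 1}. \<Sum>v\<in>{-1, 1}. prob (?A u v) * G u v)"
  proof -
    have "expectation (\<lambda>\<omega>. indicator (?A u v) \<omega> * G u v) = prob (?A u v) * G u v" for u v
      by (subst integral_mult_left_zero) (simp add: Int_def conj_commute)
    then show ?thesis
      by simp
  qed
  finally show ?thesis .
qed

text \<open>Under this law both components are uniform and \<open>\<theta> z\<close> is their
  correlation: \<open>1\<close> for identical arrows, \<open>0\<close> for independent ones.\<close>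

locale coupled_arrows = arrow_pairs +
  fixes \<theta> :: "int \<times> int \<Rightarrow> real"
  assumes site_law: "z \<in> even_lattice \<Longrightarrow> u \<in> {-1, 1} \<Longrightarrow> v \<in> {-1, 1} \<Longrightarrow>
    prob {\<omega> \<in> space M. fst (Y z \<omega>) = u \<and> snd (Y z \<omega>) = v} =
      (if u = v then 1 + \<theta> z else 1 - \<theta> z) / 4"
begin

lemma measurable_components:
  assumes "z \<in> even_lattice"
  shows "(\<lambda>\<omega>. fst (Y z \<omega>)) \<in> measurable M (count_space UNIV)"
    and "(\<lambda>\<omega>. snd (Y z \<omega>)) \<in> measurable M (count_space UNIV)"
  using measurable_comp[OF measurable_Y[OF assms], of fst "count_space UNIV"]
    measurable_comp[OF measurable_Y[OF assms], of snd "count_space UNIV"]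
  by (simp_all add: comp_def)

lemma prob_fst:
  assumes z: "z \<in> even_lattice" and u: "u \<in> {-1, 1}"
  shows "prob {\<omega> \<in> space M. fst (Y z \<omega>) = u} = 1 / 2"
proof -
  note [measurable] = measurable_components[OF z]
  have "{\<omega> \<in> space M. fst (Y z \<omega>) = u} = {\<omega> \<in> space M. fst (Y z \<omega>) = u \<and> snd (Y z \<omega>) = -1} \<union>
      {\<omega> \<in> space M. fst (Y z \<omega>) = u \<and> snd (Y z \<omega>) = 1}"
    using Y_components(2)[OF z] by auto
  then have "prob {\<omega> \<in> space M. fst (Y z \<omega>) = u} =
      prob {\<omega> \<in> space M. fst (Y z \<omega>) = u \<and> snd (Y z \<omega>) = -1} +
      prob {\<omega> \<in> space M. fst (Y z \<omega>) = u \<and> snd (Y z \<omega>) = 1}"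
    by (subst finite_measure_Union[symmetric]) auto
  then show ?thesis
    using u by (auto simp: site_law[OF z] field_simps)
qed

lemma prob_snd:
  assumes z: "z \<in> even_lattice" and v: "v \<in> {-1, 1}"
  shows "prob {\<omega> \<in> space M. snd (Y z \<omega>) = v} = 1 / 2"
proof -
  note [measurable] = measurable_components[OF z]
  have "{\<omega> \<in> space M. snd (Y z \<omega>) = v} = {\<omega> \<in> space M. fst (Y z \<omega>) = -1 \<and> snd (Y z \<omega>) = v} \<union>
      {\<omega> \<in> space M. fst (Y z \<omega>) = 1 \<and> snd (Y z \<omega>) = v}"
    using Y_components(1)[OF z] by auto
  then have "prob {\<omega> \<in> space M. snd (Y z \<omega>) = v} =
      prob {\<omega> \<in> space M. fst (Y z \<omega>) = -1 \<and> snd (Y z \<omega>) = v} +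
      prob {\<omega> \<in> space M. fst (Y z \<omega>) = 1 \<and> snd (Y z \<omega>) = v}"
    by (subst finite_measure_Union[symmetric]) auto
  then show ?thesis
    using v by (auto simp: site_law[OF z] field_simps)
qed

lemma prob_distinct_sites:
  assumes z: "z \<in> even_lattice" "z' \<in> even_lattice" "z \<noteq> z'" and uv: "u \<in> {-1, 1}" "v \<in> {-1, 1}"
  shows "prob {\<omega> \<in> space M. fst (Y z \<omega>) = u \<and> snd (Y z' \<omega>) = v} = 1 / 4"
proof -
  let ?A = "\<lambda>i. if i = z then {p. fst p = u} else {p. snd p = v}"
  have "prob (\<Inter>i\<in>{z, z'}. Y i -` ?A i \<inter> space M) = (\<Prod>i\<in>{z, z'}. prob (Y i -` ?A i \<inter> space M))"
    using z by (intro indep_varsD[OF indep_sites]) auto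
  also have "(\<Inter>i\<in>{z, z'}. Y i -` ?A i \<inter> space M) = {\<omega> \<in> space M. fst (Y z \<omega>) = u \<and> snd (Y z' \<omega>) = v}"
    using z(3) by auto
  also have "(\<Prod>i\<in>{z, z'}. prob (Y i -` ?A i \<inter> space M)) =
      prob {\<omega> \<in> space M. fst (Y z \<omega>) = u} * prob {\<omega> \<in> space M. snd (Y z' \<omega>) = v}"
    using z(3) by (simp add: vimage_def Int_def conj_commute)
  finally show ?thesis
    using z uv by (simp add: prob_fst prob_snd)
qed

lemma expectation_same_site:
  assumes z: "z \<in> even_lattice"
  shows "expectation (\<lambda>\<omega>. G (fst (Y z \<omega>)) (snd (Y z \<omega>))) =
    ((1 + \<theta> z) * (G 1 1 + G (-1) (-1)) + (1 - \<theta> z) * (G 1 (-1) + G (-1) 1)) / (4 :: real)"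
proof (subst expectation_pair_of_signs)
  show "fst (Y z \<omega>) \<in> {-1, 1} \<and> snd (Y z \<omega>) \<in> {-1, 1}" if "\<omega> \<in> space M" for \<omega>
    using Y_components[OF z that] by blast
  show "(\<Sum>u\<in>{-1, 1}. \<Sum>v\<in>{-1, 1}. prob {\<omega> \<in> space M. fst (Y z \<omega>) = u \<and> snd (Y z \<omega>) = v} * G u v) =
    ((1 + \<theta> z) * (G 1 1 + G (-1) (-1)) + (1 - \<theta> z) * (G 1 (-1) + G (-1) 1)) / 4"
    by (simp add: site_law[OF z] field_simps)
qed (use measurable_components[OF z] in auto)

lemma expectation_distinct_sites:
  assumes z: "z \<in> even_lattice" "z' \<in> even_lattice" "z \<noteq> z'"
  shows "expectation (\<lambda>\<omega>. G (fst (Y z \<omega>)) (snd (Y z' \<omega>))) =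
    (G 1 1 + G (-1) (-1) + G 1 (-1) + G (-1) 1) / (4 :: real)"
proof (subst expectation_pair_of_signs)
  show "fst (Y z \<omega>) \<in> {-1, 1} \<and> snd (Y z' \<omega>) \<in> {-1, 1}" if "\<omega> \<in> space M" for \<omega>
    using Y_components(1)[OF z(1) that] Y_components(2)[OF z(2) that] by blast
  show "(\<Sum>u\<in>{-1, 1}. \<Sum>v\<in>{-1, 1}. prob {\<omega> \<in> space M. fst (Y z \<omega>) = u \<and> snd (Y z' \<omega>) = v} * G u v) =
    (G 1 1 + G (-1) (-1) + G 1 (-1) + G (-1) 1) / 4"
    by (simp add: prob_distinct_sites[OF z] field_simps)
qed (use measurable_components[OF z(1)] measurable_components[OF z(2)] in auto)

lemma expectation_exp_walk1: "expectation (\<lambda>\<omega>. exp (l * real_of_int (walk1 n \<omega>))) = cosh l ^ n"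
proof (induction n)
  case 0
  show ?case by (simp add: prob_space)
next
  case (Suc n)
  have *: "expectation (\<lambda>\<omega>'. exp (l * real_of_int (x + fst (Y (x, int n) \<omega>')))) =
      cosh l * exp (l * real_of_int x)" if "(x, int n) \<in> even_lattice" for x
    \<comment> \<open>The integrand ignores the second component, so the terms with
      \<open>\<theta>\<close> cancel.\<close>
    by (subst expectation_same_site[OF that, of "\<lambda>u v. exp (l * real_of_int (x + u))"])
       (simp add: cosh_field_def field_simps exp_add exp_diff exp_minus)
  have "expectation (\<lambda>\<omega>. exp (l * real_of_int (walk1 (Suc n) \<omega>))) =
      expectation (\<lambda>\<omega>. (\<lambda>x. expectation (\<lambda>\<omega>'. exp (l * real_of_int (x + fst (Y (x, int n) \<omega>')))))
        (walk1 n \<omega>))"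
    using expectation_step[of "\<lambda>x y. exp (l * real_of_int x)" n] by simp
  also have "\<dots> = expectation (\<lambda>\<omega>. cosh l * exp (l * real_of_int (walk1 n \<omega>)))"
    by (intro Bochner_Integration.integral_cong refl) (simp only: *[OF walk_lattice(1)])
  finally show ?case
    by (simp add: Suc)
qed

text \<open>
  A supersolution for the pair of walks under the exponential tilt: its kink at distance \<open>0\<close> pays
  for the positive correlation of the two steps taken from a common site.
\<close>

definition barrier :: "real \<Rightarrow> real \<Rightarrow> int \<Rightarrow> real" where
  "barrier \<kappa> \<mu> d = 1 + \<kappa> * exp (- (\<mu> * real_of_int \<bar>d\<bar>))"

text \<open>Away from the diagonal the steps are independent, and the barrier, being exponential in
  the distance, grows on average by a term proportional to \<open>(sinh \<mu>)\<^sup>2\<close>. At a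
  common site the correlation yields at most an extra
  \<open>(sinh l)\<^sup>2 * (1 + \<kappa>)\<close>, but with probability
  \<open>(1 - \<theta> z) / 2\<close> the walks separate and the barrier drops by
  \<open>\<kappa> * (1 - exp (- (2 * \<mu>)))\<close>. The condition \<open>meeting\<close> says
  that this loss outweighs the gain.\<close>

lemma exp_pair_step:
  assumes lattice: "(x, int n) \<in> even_lattice" "(y, int n) \<in> even_lattice"
    and \<kappa>: "0 \<le> \<kappa>" and \<mu>: "0 \<le> \<mu>"
    and meeting: "\<And>z. z \<in> even_lattice \<Longrightarrow>
      2 * (sinh l)\<^sup>2 * (1 + \<kappa>) \<le> (1 - \<theta> z) * \<kappa> * (1 - exp (- (2 * \<mu>)))"
    and \<theta>: "\<And>z. z \<in> even_lattice \<Longrightarrow> \<theta> z \<le> 1"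
  defines "H \<equiv> \<lambda>x y. exp (l * real_of_int (x + y)) * barrier \<kappa> \<mu> (x - y)"
  shows "expectation (\<lambda>\<omega>. H (x + fst (Y (x, int n) \<omega>)) (y + snd (Y (y, int n) \<omega>)))
    \<le> (cosh l)\<^sup>2 * (1 + \<kappa> * (sinh \<mu>)\<^sup>2) * H x y"
proof (cases "x = y")
  case True
  let ?\<theta> = "\<theta> (x, int n)"
  let ?E = "exp (l * real_of_int (x + x))"
  let ?e = "exp (- (2 * \<mu>))"
  have "expectation (\<lambda>\<omega>. H (x + fst (Y (x, int n) \<omega>)) (y + snd (Y (y, int n) \<omega>))) =
      ((1 + ?\<theta>) * (H (x + 1) (x + 1) + H (x - 1) (x - 1)) +
       (1 - ?\<theta>) * (H (x + 1) (x - 1) + H (x - 1) (x + 1))) / 4"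
    unfolding True[symmetric]
    using expectation_same_site[OF lattice(1), of "\<lambda>u v. H (x + u) (x + v)"] by simp
  also have "\<dots> = ?E * ((1 + ?\<theta>) * (2 * cosh (2 * l)) * (1 + \<kappa>) + (1 - ?\<theta>) * 2 * (1 + \<kappa> * ?e)) / 4"
  proof -
    have "exp (l * real_of_int (x + 1 + (x + 1))) = ?E * exp (2 * l)"
      "exp (l * real_of_int (x - 1 + (x - 1))) = ?E * exp (- (2 * l))"
      by (simp_all add: algebra_simps flip: exp_add)
    then have "H (x + 1) (x + 1) = ?E * exp (2 * l) * (1 + \<kappa>)"
      "H (x - 1) (x - 1) = ?E * exp (- (2 * l)) * (1 + \<kappa>)"
      "H (x + 1) (x - 1) = ?E * (1 + \<kappa> * ?e)" "H (x - 1) (x + 1) = ?E * (1 + \<kappa> * ?e)"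
      by (simp_all add: H_def barrier_def mult.commute)
    then show ?thesis
      by (simp add: cosh_field_def field_simps)
  qed
  \<comment> \<open>The factor \<open>(cosh l)\<^sup>2\<close> of two independent steps is isolated;
    what remains is the gain from the correlation minus the loss from separating.\<close>
  also have "\<dots> = ?E * ((cosh l)\<^sup>2 * (1 + \<kappa>) + (?\<theta> * (sinh l)\<^sup>2 * (1 + \<kappa>) - (1 - ?\<theta>) * \<kappa> * (1 - ?e) / 2))"
    unfolding cosh_double cosh_square_eq by (simp add: field_simps)
  also have "\<dots> \<le> ?E * ((cosh l)\<^sup>2 * (1 + \<kappa>))"
  proof (rule mult_left_mono)
    have "?\<theta> * (sinh l)\<^sup>2 * (1 + \<kappa>) \<le> 1 * (sinh l)\<^sup>2 * (1 + \<kappa>)"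
      using \<theta>[OF lattice(1)] \<kappa> by (intro mult_right_mono) auto
    then show "(cosh l)\<^sup>2 * (1 + \<kappa>) + (?\<theta> * (sinh l)\<^sup>2 * (1 + \<kappa>) - (1 - ?\<theta>) * \<kappa> * (1 - ?e) / 2)
        \<le> (cosh l)\<^sup>2 * (1 + \<kappa>)"
      using meeting[OF lattice(1)] by simp
  qed simp
  also have "\<dots> = (cosh l)\<^sup>2 * 1 * H x y"
    by (simp add: H_def barrier_def True)
  also have "\<dots> \<le> (cosh l)\<^sup>2 * (1 + \<kappa> * (sinh \<mu>)\<^sup>2) * H x y"
    using \<kappa> by (intro mult_right_mono mult_left_mono) (auto simp: H_def barrier_def)
  finally show ?thesis .
next
  case False
  define D where "D = x - y"
  let ?E = "exp (l * real_of_int (x + y))"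
  let ?b = "barrier \<kappa> \<mu>"
  let ?q = "exp (- (\<mu> * real_of_int \<bar>D\<bar>))"
  \<comment> \<open>By parity two distinct sites of equal time are at distance at least 2, so one
    step can reach the kink of the barrier but not jump over it.\<close>
  have "even D" "D \<noteq> 0"
    using lattice False by (auto simp: even_lattice_def D_def)
  then have D: "\<bar>D\<bar> \<ge> 2"
    by presburger
  have D2: "\<bar>D + 2\<bar> = \<bar>D\<bar> + 2 \<and> \<bar>D - 2\<bar> = \<bar>D\<bar> - 2 \<or> \<bar>D + 2\<bar> = \<bar>D\<bar> - 2 \<and> \<bar>D - 2\<bar> = \<bar>D\<bar> + 2"
    using D by auto
  have b2: "?b (D + 2) + ?b (D - 2) = 2 * ?b D + 4 * \<kappa> * ?q * (sinh \<mu>)\<^sup>2"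
  proof -
    have "?b (D + 2) + ?b (D - 2) = 2 + \<kappa> * ?q * (2 * cosh (2 * \<mu>))"
      using D2 by (auto simp: barrier_def cosh_field_def field_simps exp_add exp_diff exp_minus)
    then show ?thesis
      unfolding cosh_double cosh_square_eq by (simp add: barrier_def field_simps)
  qed
  have "expectation (\<lambda>\<omega>. H (x + fst (Y (x, int n) \<omega>)) (y + snd (Y (y, int n) \<omega>))) =
      (H (x + 1) (y + 1) + H (x - 1) (y - 1) + H (x + 1) (y - 1) + H (x - 1) (y + 1)) / 4"
    using expectation_distinct_sites[OF lattice, of "\<lambda>u v. H (x + u) (y + v)"] False by simp
  also have "\<dots> = ?E * (2 * cosh (2 * l) * ?b D + (?b (D + 2) + ?b (D - 2))) / 4"
  proof -
    have e: "exp (l * real_of_int (x + 1 + (y + 1))) = ?E * exp (2 * l)"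
      "exp (l * real_of_int (x - 1 + (y - 1))) = ?E * exp (- (2 * l))"
      by (simp_all add: algebra_simps flip: exp_add)
    have d: "x + 1 - (y + 1) = D" "x - 1 - (y - 1) = D" "x + 1 - (y - 1) = D + 2" "x - 1 - (y + 1) = D - 2"
      "x + 1 + (y - 1) = x + y" "x - 1 + (y + 1) = x + y"
      by (simp_all add: D_def)
    have "H (x + 1) (y + 1) = ?E * exp (2 * l) * ?b D"
      "H (x - 1) (y - 1) = ?E * exp (- (2 * l)) * ?b D"
      "H (x + 1) (y - 1) = ?E * ?b (D + 2)" "H (x - 1) (y + 1) = ?E * ?b (D - 2)"
      by (simp_all only: H_def d e)
    then show ?thesis
      by (simp add: cosh_field_def field_simps)
  qed
  also have "\<dots> = ?E * ((cosh l)\<^sup>2 * ?b D + \<kappa> * (sinh \<mu>)\<^sup>2 * ?q)"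
    unfolding b2 cosh_double cosh_square_eq by (simp add: field_simps)
  \<comment> \<open>The additive error becomes a multiplicative one, because \<open>?q\<close> is at
    most 1 while \<open>cosh l\<close> and the barrier are at least 1.\<close>
  also have "\<dots> \<le> ?E * ((cosh l)\<^sup>2 * ?b D + \<kappa> * (sinh \<mu>)\<^sup>2 * ((cosh l)\<^sup>2 * ?b D))"
  proof (intro mult_left_mono add_left_mono)
    have "?q \<le> 1"
      using \<mu> by simp
    also have "1 \<le> ?b D"
      using \<kappa> by (simp add: barrier_def)
    finally have "1 * ?q \<le> (cosh l)\<^sup>2 * ?b D"
      by (intro mult_mono) (auto simp: cosh_real_ge_1)
    then show "?q \<le> (cosh l)\<^sup>2 * ?b D" by simp
  qed (use \<kappa> in auto)
  also have "\<dots> = (cosh l)\<^sup>2 * (1 + \<kappa> * (sinh \<mu>)\<^sup>2) * H x y"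
    by (simp add: H_def D_def field_simps)
  finally show ?thesis .
qed

text \<open>The one-step bound is iterated from the origin, where the barrier equals
  \<open>1 + \<kappa>\<close>; at the end the barrier is dropped, as it is at least 1.\<close>

lemma expectation_exp_pair:
  assumes \<kappa>: "0 \<le> \<kappa>" and \<mu>: "0 \<le> \<mu>"
    and meeting: "\<And>z. z \<in> even_lattice \<Longrightarrow>
      2 * (sinh l)\<^sup>2 * (1 + \<kappa>) \<le> (1 - \<theta> z) * \<kappa> * (1 - exp (- (2 * \<mu>)))"
    and \<theta>: "\<And>z. z \<in> even_lattice \<Longrightarrow> \<theta> z \<le> 1"
  shows "expectation (\<lambda>\<omega>. exp (l * real_of_int (walk1 n \<omega> + walk2 n \<omega>)))
    \<le> (cosh l) ^ (2 * n) * (1 + \<kappa> * (sinh \<mu>)\<^sup>2) ^ n * (1 + \<kappa>)"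
proof -
  define H where "H x y = exp (l * real_of_int (x + y)) * barrier \<kappa> \<mu> (x - y)" for x y
  let ?r = "(cosh l)\<^sup>2 * (1 + \<kappa> * (sinh \<mu>)\<^sup>2)"
  have r: "0 \<le> ?r"
    using \<kappa> by simp
  have "expectation (\<lambda>\<omega>. H (walk1 n \<omega>) (walk2 n \<omega>)) \<le> ?r ^ n * (1 + \<kappa>)"
  proof (induction n)
    case 0
    show ?case
      by (simp add: H_def barrier_def prob_space)
  next
    case (Suc n)
    have "expectation (\<lambda>\<omega>. H (walk1 (Suc n) \<omega>) (walk2 (Suc n) \<omega>)) \<le>
        expectation (\<lambda>\<omega>. ?r * H (walk1 n \<omega>) (walk2 n \<omega>))"
      unfolding expectation_step
    proof (rule integral_mono)
      show "integrable M (\<lambda>\<omega>. ?r * H (walk1 n \<omega>) (walk2 n \<omega>))"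
        by (rule bounded_walk_integrable[of "\<lambda>x y. ?r * H x y"])
      show "expectation (\<lambda>\<omega>'. H (walk1 n \<omega> + fst (Y (walk1 n \<omega>, int n) \<omega>'))
          (walk2 n \<omega> + snd (Y (walk2 n \<omega>, int n) \<omega>'))) \<le> ?r * H (walk1 n \<omega>) (walk2 n \<omega>)"
        if "\<omega> \<in> space M" for \<omega>
        using exp_pair_step[OF walk_lattice(1,2)[OF that] \<kappa> \<mu> meeting \<theta>] by (simp only: H_def)
    qed (rule bounded_walk_integrable)
    also have "\<dots> = ?r * expectation (\<lambda>\<omega>. H (walk1 n \<omega>) (walk2 n \<omega>))"
      by simp
    also have "\<dots> \<le> ?r * (?r ^ n * (1 + \<kappa>))"
      by (rule mult_left_mono[OF Suc r])
    finally show ?case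
      by (simp add: mult.assoc)
  qed
  moreover have "expectation (\<lambda>\<omega>. exp (l * real_of_int (walk1 n \<omega> + walk2 n \<omega>))) \<le>
      expectation (\<lambda>\<omega>. H (walk1 n \<omega>) (walk2 n \<omega>))"
  proof (rule integral_mono)
    show "exp (l * real_of_int (walk1 n \<omega> + walk2 n \<omega>)) \<le> H (walk1 n \<omega>) (walk2 n \<omega>)" for \<omega>
      using \<kappa> by (simp add: H_def barrier_def)
  qed (rule bounded_walk_integrable[of "\<lambda>x y. exp (l * real_of_int (x + y))"] bounded_walk_integrable[of H])+
  ultimately show ?thesis
    by (simp add: power_mult_distrib power_mult)
qed

end

subsection \<open>The law of a site at two dynamical times\<close>

text \<open>A conditional probability that is the same given each of countably many values is also
  the conditional probability given their union. It is meant for pairs of ring counts, grouped into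
  equal and unequal ones.\<close>

lemma (in prob_space) prob_constant_ratio_on_fibres:
  fixes Z :: "'a \<Rightarrow> 'b :: countable"
  assumes Z [measurable]: "Z \<in> measurable M (count_space UNIV)" and E [measurable]: "E \<in> events"
    and q: "0 \<le> q" and ratio: "\<And>k. k \<in> K \<Longrightarrow> prob (E \<inter> {\<omega> \<in> space M. Z \<omega> = k}) = q * prob {\<omega> \<in> space M. Z \<omega> = k}"
  shows "prob (E \<inter> {\<omega> \<in> space M. Z \<omega> \<in> K}) = q * prob {\<omega> \<in> space M. Z \<omega> \<in> K}"
proof -
  have union: "emeasure M (F \<inter> {\<omega> \<in> space M. Z \<omega> \<in> K}) =
      (\<integral>\<^sup>+k. emeasure M (F \<inter> {\<omega> \<in> space M. Z \<omega> = k}) \<partial>count_space K)"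
    if [measurable]: "F \<in> events" for F
  proof -
    have "F \<inter> {\<omega> \<in> space M. Z \<omega> \<in> K} = (\<Union>k\<in>K. F \<inter> {\<omega> \<in> space M. Z \<omega> = k})"
      by auto
    then show ?thesis
      by (simp only:) (rule emeasure_UN_countable, auto simp: disjoint_family_on_def)
  qed
  have "emeasure M (E \<inter> {\<omega> \<in> space M. Z \<omega> \<in> K}) =
      (\<integral>\<^sup>+k. ennreal q * emeasure M (space M \<inter> {\<omega> \<in> space M. Z \<omega> = k}) \<partial>count_space K)"
    unfolding union[OF E]
  proof (rule nn_integral_cong)
    fix k assume "k \<in> space (count_space K)"
    then have "prob (E \<inter> {\<omega> \<in> space M. Z \<omega> = k}) = q * prob {\<omega> \<in> space M. Z \<omega> = k}"
      using ratio by simp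
    moreover have "space M \<inter> {\<omega> \<in> space M. Z \<omega> = k} = {\<omega> \<in> space M. Z \<omega> = k}"
      by auto
    ultimately show "emeasure M (E \<inter> {\<omega> \<in> space M. Z \<omega> = k}) =
        ennreal q * emeasure M (space M \<inter> {\<omega> \<in> space M. Z \<omega> = k})"
      using q by (simp add: emeasure_eq_measure ennreal_mult)
  qed
  also have "\<dots> = ennreal q * emeasure M (space M \<inter> {\<omega> \<in> space M. Z \<omega> \<in> K})"
    unfolding union[OF sets.top] by (rule nn_integral_cmult) simp
  also have "space M \<inter> {\<omega> \<in> space M. Z \<omega> \<in> K} = {\<omega> \<in> space M. Z \<omega> \<in> K}"
    by auto
  finally show ?thesis
    using q by (simp add: emeasure_eq_measure ennreal_mult[symmetric] ennreal_inj)
qed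

lemma measurable_ring_count:
  assumes "\<And>n. (\<lambda>x. g x n) \<in> borel_measurable N"
  shows "(\<lambda>x. ring_count (g x) \<tau>) \<in> measurable N (count_space UNIV)"
  unfolding ring_count_def ring_time_def using assms by measurable

lemma measurable_site_value:
  assumes "\<And>n. (\<lambda>x. g x n) \<in> borel_measurable N" "\<And>n. (\<lambda>x. s x n) \<in> measurable N (count_space UNIV)"
  shows "(\<lambda>x. site_value (g x) (s x) \<tau>) \<in> measurable N (count_space UNIV)"
  unfolding site_value_def
  by (rule measurable_compose_countable[where f = "\<lambda>n x. s x n", OF assms(2) measurable_ring_count[OF assms(1)]])

text \<open>With positive gaps, a single gap longer than 1 pushes all rings from its index on beyond
  time 1. This excludes the default value of \<open>card\<close> in
  \<open>ring_count\<close>.\<close>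

lemma finite_rings:
  assumes pos: "\<And>n. 0 < g n" and large: "1 < g n"
  shows "finite {m. ring_time g m \<le> 1}"
proof (rule finite_subset)
  show "{m. ring_time g m \<le> 1} \<subseteq> {..<n}"
  proof (rule subsetI, rule ccontr)
    fix m assume m: "m \<in> {m. ring_time g m \<le> 1}" "m \<notin> {..<n}"
    have "g n \<le> ring_time g m"
      unfolding ring_time_def using m(2) pos by (intro member_le_sum) (auto intro: less_imp_le)
    then show False
      using m(1) large by simp
  qed
qed simp

text \<open>Each ring later than \<open>\<tau>\<close> leaves some room to the right of
  \<open>\<tau>\<close>, and only finitely many rings compete; those after time 1 are avoided by
  staying below 1.\<close>

lemma ring_count_right_constant:
  assumes fin: "finite {n. ring_time g n \<le> 1}" and \<tau>: "\<tau> < 1"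
  shows "\<forall>\<^sub>F \<tau>' in at_right \<tau>. ring_count g \<tau>' = ring_count g \<tau>"
proof -
  have "\<forall>\<^sub>F \<tau>' in at_right \<tau>. \<forall>n\<in>{n. ring_time g n \<le> 1}. ring_time g n \<le> \<tau>' \<longleftrightarrow> ring_time g n \<le> \<tau>"
  proof (rule eventually_ball_finite[OF fin], rule ballI)
    fix n
    show "\<forall>\<^sub>F \<tau>' in at_right \<tau>. ring_time g n \<le> \<tau>' \<longleftrightarrow> ring_time g n \<le> \<tau>"
    proof (cases "ring_time g n \<le> \<tau>")
      case True
      then show ?thesis
        by (auto simp: eventually_at_filter intro!: always_eventually)
    next
      case False
      then show ?thesis
        by (auto simp: eventually_at_right[of \<tau> "ring_time g n"] not_le intro!: exI[of _ "ring_time g n"])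
    qed
  qed
  moreover have "\<forall>\<^sub>F \<tau>' in at_right \<tau>. \<tau>' < 1"
    using \<tau> by (auto simp: eventually_at_right[of \<tau> 1] intro!: exI[of _ 1])
  ultimately show ?thesis
  proof eventually_elim
    case (elim \<tau>')
    have "ring_time g n \<le> \<tau>' \<longleftrightarrow> ring_time g n \<le> \<tau>" for n
      using elim \<tau> by (cases "ring_time g n \<le> 1") auto
    then show ?case
      by (simp add: ring_count_def)
  qed
qed

section \<open>Ring counts and arrows of the web at two dynamical times\<close>

context dynamical_web
begin

definition draws :: "(int \<times> int) \<times> nat + (int \<times> int) \<times> nat \<Rightarrow> 'a \<Rightarrow> real" where
  "draws = case_sum (\<lambda>(z, n) \<omega>. gap z n \<omega>) (\<lambda>(z, n) \<omega>. real_of_int (spin z n \<omega>))"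

lemma draws_simps [simp]:
  "draws (Inl (z, n)) = gap z n" "draws (Inr (z, n)) = (\<lambda>\<omega>. real_of_int (spin z n \<omega>))"
  by (simp_all add: draws_def)

lemma indep_draws:
  "indep_vars (\<lambda>_. borel) draws ((even_lattice \<times> UNIV) <+> (even_lattice \<times> UNIV))"
  using gap_spin_indep by (simp add: draws_def)

lemma measurable_gap:
  assumes "z \<in> even_lattice"
  shows "gap z n \<in> borel_measurable M"
  using indep_draws assms
  by (force simp: indep_vars_def dest!: bspec[of _ _ "Inl (z, n)"])

lemma measurable_spin:
  assumes "z \<in> even_lattice"
  shows "spin z n \<in> measurable M (count_space UNIV)"
proof -
  have [measurable]: "(\<lambda>\<omega>. real_of_int (spin z n \<omega>)) \<in> borel_measurable M"
    using indep_draws assms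
    by (force simp: indep_vars_def dest!: bspec[of _ _ "Inr (z, n)"])
  \<comment> \<open>The floor undoes the embedding of the spins into the reals.\<close>
  have "(\<lambda>\<omega>. \<lfloor>real_of_int (spin z n \<omega>)\<rfloor>) \<in> measurable M (count_space UNIV)"
    by measurable
  then show ?thesis
    by simp
qed

text \<open>Built from \<open>gap\<close> and \<open>spin\<close> instead of \<open>\<xi>\<close>,
  which is tied to them only on the lattice and for non-negative dynamical times.\<close>

definition value_pair :: "real \<Rightarrow> real \<Rightarrow> int \<times> int \<Rightarrow> 'a \<Rightarrow> int \<times> int" where
  "value_pair \<tau> \<tau>' z \<omega> = (site_value (\<lambda>n. gap z n \<omega>) (\<lambda>n. spin z n \<omega>) \<tau>,
     site_value (\<lambda>n. gap z n \<omega>) (\<lambda>n. spin z n \<omega>) \<tau>')"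

definition count_pair :: "real \<Rightarrow> real \<Rightarrow> int \<times> int \<Rightarrow> 'a \<Rightarrow> nat \<times> nat" where
  "count_pair \<tau> \<tau>' z \<omega> = (ring_count (\<lambda>n. gap z n \<omega>) \<tau>, ring_count (\<lambda>n. gap z n \<omega>) \<tau>')"

text \<open>Equal ring counts mean that both dynamical times read the same draw; this probability
  becomes the correlation \<open>\<theta>\<close> of the two arrows.\<close>

definition overlap :: "real \<Rightarrow> real \<Rightarrow> int \<times> int \<Rightarrow> real" where
  "overlap \<tau> \<tau>' z = prob {\<omega> \<in> space M. fst (count_pair \<tau> \<tau>' z \<omega>) = snd (count_pair \<tau> \<tau>' z \<omega>)}"

lemma measurable_count_pair:
  assumes "z \<in> even_lattice"
  shows "count_pair \<tau> \<tau>' z \<in> measurable M (count_space UNIV)"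
  unfolding count_pair_def[abs_def]
  by (intro measurable_count_space_Pair measurable_ring_count measurable_gap assms)

lemma measurable_value_pair:
  assumes "z \<in> even_lattice"
  shows "value_pair \<tau> \<tau>' z \<in> measurable M (count_space UNIV)"
  unfolding value_pair_def[abs_def]
  by (intro measurable_count_space_Pair measurable_site_value measurable_gap measurable_spin assms)

text \<open>Each pair is a measurable function of the block of draws that belongs to its site, and
  these blocks are disjoint.\<close>

lemma indep_value_pairs: "indep_vars (\<lambda>_. count_space UNIV) (value_pair \<tau> \<tau>') even_lattice"
proof -
  define K :: "int \<times> int \<Rightarrow> ((int \<times> int) \<times> nat + (int \<times> int) \<times> nat) set"
    where "K z = range (\<lambda>n. Inl (z, n)) \<union> range (\<lambda>n. Inr (z, n))" for z
  define \<Phi> :: "int \<times> int \<Rightarrow> ((int \<times> int) \<times> nat + (int \<times> int) \<times> nat \<Rightarrow> real) \<Rightarrow> int \<times> int"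
    where "\<Phi> z f = (site_value (\<lambda>n. f (Inl (z, n))) (\<lambda>n. \<lfloor>f (Inr (z, n))\<rfloor>) \<tau>,
      site_value (\<lambda>n. f (Inl (z, n))) (\<lambda>n. \<lfloor>f (Inr (z, n))\<rfloor>) \<tau>')" for z f
  have "indep_vars (\<lambda>z. PiM (K z) (\<lambda>_. borel)) (\<lambda>z \<omega>. restrict (\<lambda>i. draws i \<omega>) (K z)) even_lattice"
    by (rule indep_vars_restrict[OF indep_draws]) (auto simp: K_def disjoint_family_on_def)
  then have "indep_vars (\<lambda>_. count_space UNIV) (\<lambda>z \<omega>. \<Phi> z (restrict (\<lambda>i. draws i \<omega>) (K z))) even_lattice"
  proof (rule indep_vars_compose2)
    fix z
    have gaps: "(\<lambda>f. f (Inl (z, n))) \<in> borel_measurable (PiM (K z) (\<lambda>_. borel))" for n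
      by (rule measurable_component_singleton) (simp add: K_def)
    have [measurable]: "(\<lambda>f. f (Inr (z, n))) \<in> borel_measurable (PiM (K z) (\<lambda>_. borel))" for n
      by (rule measurable_component_singleton) (simp add: K_def)
    have spins: "(\<lambda>f. \<lfloor>f (Inr (z, n))\<rfloor>) \<in> measurable (PiM (K z) (\<lambda>_. borel :: real measure)) (count_space UNIV)" for n
      by measurable
    show "\<Phi> z \<in> measurable (PiM (K z) (\<lambda>_. borel)) (count_space UNIV)"
      unfolding \<Phi>_def[abs_def]
      by (intro measurable_count_space_Pair measurable_site_value gaps spins)
  qed
  moreover have "(\<lambda>z \<omega>. \<Phi> z (restrict (\<lambda>i. draws i \<omega>) (K z))) = value_pair \<tau> \<tau>'"
    by (simp add: \<Phi>_def value_pair_def K_def fun_eq_iff)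
  ultimately show ?thesis
    by simp
qed

text \<open>The counts depend on gaps only, hence are independent of the spins. Two draws with the
  same index coincide, and draws with different indices are independent and fair.\<close>

lemma prob_counts_and_spins:
  assumes z: "z \<in> even_lattice" and uv: "u \<in> {-1, 1}" "v \<in> {-1, 1}"
  shows "prob {\<omega> \<in> space M. count_pair \<tau> \<tau>' z \<omega> = (i, j) \<and> spin z i \<omega> = u \<and> spin z j \<omega> = v} =
    (if i = j then if u = v then 1 / 2 else 0 else 1 / 4) *
    prob {\<omega> \<in> space M. count_pair \<tau> \<tau>' z \<omega> = (i, j)}"
proof -
  let ?I = "(even_lattice \<times> UNIV) <+> (even_lattice \<times> UNIV) :: ((int \<times> int) \<times> nat + (int \<times> int) \<times> nat) set"
  let ?G = "range (\<lambda>n. Inl (z, n)) :: ((int \<times> int) \<times> nat + (int \<times> int) \<times> nat) set"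
  let ?S = "range (\<lambda>n. Inr (z, n)) :: ((int \<times> int) \<times> nat + (int \<times> int) \<times> nat) set"
  \<comment> \<open>The counts are cast to integers since the two variables of
    \<open>indep_var\<close> share one range type, here that of a pair of spins.\<close>
  define fG :: "((int \<times> int) \<times> nat + (int \<times> int) \<times> nat \<Rightarrow> real) \<Rightarrow> int \<times> int"
    where "fG f = map_prod int int
      (ring_count (\<lambda>n. f (Inl (z, n))) \<tau>, ring_count (\<lambda>n. f (Inl (z, n))) \<tau>')" for f
  define fS :: "((int \<times> int) \<times> nat + (int \<times> int) \<times> nat \<Rightarrow> real) \<Rightarrow> int \<times> int"
    where "fS f = (\<lfloor>f (Inr (z, i))\<rfloor>, \<lfloor>f (Inr (z, j))\<rfloor>)" for f
  have "indep_var (PiM ?G (\<lambda>_. borel)) (\<lambda>\<omega>. restrict (\<lambda>i. draws i \<omega>) ?G)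
      (PiM ?S (\<lambda>_. borel)) (\<lambda>\<omega>. restrict (\<lambda>i. draws i \<omega>) ?S)"
    using z by (intro indep_var_restrict[OF indep_draws]) auto
  moreover have "fG \<in> measurable (PiM ?G (\<lambda>_. borel)) (count_space UNIV)"
  proof -
    have "(\<lambda>f. (ring_count (\<lambda>n. f (Inl (z, n))) \<tau>, ring_count (\<lambda>n. f (Inl (z, n))) \<tau>'))
        \<in> measurable (PiM ?G (\<lambda>_. borel)) (count_space UNIV)"
      by (intro measurable_count_space_Pair measurable_ring_count measurable_component_singleton) auto
    from measurable_comp[OF this, of "map_prod int int" "count_space UNIV"] show ?thesis
      by (simp add: fG_def[abs_def] comp_def)
  qed
  moreover have "fS \<in> measurable (PiM ?S (\<lambda>_. borel)) (count_space UNIV)"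
  proof -
    have [measurable]: "(\<lambda>f. f (Inr (z, n))) \<in> borel_measurable (PiM ?S (\<lambda>_. borel))" for n
      by (rule measurable_component_singleton) simp
    have "(\<lambda>f. \<lfloor>f (Inr (z, n))\<rfloor>) \<in> measurable (PiM ?S (\<lambda>_. borel :: real measure)) (count_space UNIV)" for n
      by measurable
    then show ?thesis
      unfolding fS_def[abs_def] by (intro measurable_count_space_Pair)
  qed
  ultimately have "indep_var (count_space UNIV) (fG \<circ> (\<lambda>\<omega>. restrict (\<lambda>i. draws i \<omega>) ?G))
      (count_space UNIV) (fS \<circ> (\<lambda>\<omega>. restrict (\<lambda>i. draws i \<omega>) ?S))"
    by (rule indep_var_compose)
  moreover have "fG \<circ> (\<lambda>\<omega>. restrict (\<lambda>i. draws i \<omega>) ?G) = map_prod int int \<circ> count_pair \<tau> \<tau>' z"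
    by (simp add: fG_def count_pair_def fun_eq_iff)
  moreover have "fS \<circ> (\<lambda>\<omega>. restrict (\<lambda>i. draws i \<omega>) ?S) = (\<lambda>\<omega>. (spin z i \<omega>, spin z j \<omega>))"
    by (simp add: fS_def fun_eq_iff)
  ultimately have "indep_var (count_space UNIV) (map_prod int int \<circ> count_pair \<tau> \<tau>' z)
      (count_space UNIV) (\<lambda>\<omega>. (spin z i \<omega>, spin z j \<omega>))"
    by simp
  moreover have "map_prod int int (count_pair \<tau> \<tau>' z \<omega>) = (int i, int j) \<longleftrightarrow> count_pair \<tau> \<tau>' z \<omega> = (i, j)" for \<omega>
    by (cases "count_pair \<tau> \<tau>' z \<omega>") simp
  ultimately
  have "prob {\<omega> \<in> space M. count_pair \<tau> \<tau>' z \<omega> = (i, j) \<and> spin z i \<omega> = u \<and> spin z j \<omega> = v} =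
      prob {\<omega> \<in> space M. count_pair \<tau> \<tau>' z \<omega> = (i, j)} *
      prob {\<omega> \<in> space M. spin z i \<omega> = u \<and> spin z j \<omega> = v}"
    using indep_varD[of "count_space UNIV" "map_prod int int \<circ> count_pair \<tau> \<tau>' z" "count_space UNIV"
        "\<lambda>\<omega>. (spin z i \<omega>, spin z j \<omega>)" "{(int i, int j)}" "{(u, v)}"]
    by (simp add: vimage_def Int_def conj_commute conj_left_commute)
  moreover have "prob {\<omega> \<in> space M. spin z i \<omega> = u \<and> spin z j \<omega> = v} =
      (if i = j then if u = v then 1 / 2 else 0 else 1 / 4)"
  proof (cases "i = j")
    case True
    show ?thesis
    proof (cases "u = v")
      case False
      with True have empty: "{\<omega> \<in> space M. spin z i \<omega> = u \<and> spin z j \<omega> = v} = {}"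
        by auto
      show ?thesis
        unfolding empty using True False by simp
    qed (use True spin_uniform[OF z uv(1)] in simp)
  next
    case False
    let ?A = "\<lambda>k. if k = Inr (z, i) then {real_of_int u} else {real_of_int v}"
    have "prob (\<Inter>k\<in>{Inr (z, i), Inr (z, j)}. draws k -` ?A k \<inter> space M) =
        (\<Prod>k\<in>{Inr (z, i), Inr (z, j)}. prob (draws k -` ?A k \<inter> space M))"
      using z by (intro indep_varsD[OF indep_draws]) auto
    also have "(\<Inter>k\<in>{Inr (z, i), Inr (z, j)}. draws k -` ?A k \<inter> space M) =
        {\<omega> \<in> space M. spin z i \<omega> = u \<and> spin z j \<omega> = v}"
      using False by auto
    also have "(\<Prod>k\<in>{Inr (z, i), Inr (z, j)}. prob (draws k -` ?A k \<inter> space M)) =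
        prob {\<omega> \<in> space M. spin z i \<omega> = u} * prob {\<omega> \<in> space M. spin z j \<omega> = v}"
      using False by (simp add: vimage_def Int_def conj_commute)
    finally show ?thesis
      using False uv by (simp add: spin_uniform[OF z])
  qed
  ultimately show ?thesis
    by simp
qed

text \<open>Given equal counts the two values are one fair sign, given different counts they are two
  independent ones; mixing these laws with weights \<open>overlap\<close> and its complement gives
  the formula.\<close>

lemma value_pair_law:
  assumes z: "z \<in> even_lattice" and uv: "u \<in> {-1, 1}" "v \<in> {-1, 1}"
  shows "prob {\<omega> \<in> space M. fst (value_pair \<tau> \<tau>' z \<omega>) = u \<and> snd (value_pair \<tau> \<tau>' z \<omega>) = v} =
    (if u = v then 1 + overlap \<tau> \<tau>' z else 1 - overlap \<tau> \<tau>' z) / 4"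
proof -
  note [measurable] = measurable_count_pair[OF z, of \<tau> \<tau>'] measurable_value_pair[OF z, of \<tau> \<tau>']
  let ?E = "{\<omega> \<in> space M. fst (value_pair \<tau> \<tau>' z \<omega>) = u \<and> snd (value_pair \<tau> \<tau>' z \<omega>) = v}"
  let ?C = "\<lambda>K. {\<omega> \<in> space M. count_pair \<tau> \<tau>' z \<omega> \<in> K}"
  have E: "?E \<in> events"
  proof -
    have "{\<omega> \<in> space M. value_pair \<tau> \<tau>' z \<omega> = (u, v)} \<in> events"
      by measurable
    then show ?thesis
      by (simp add: prod_eq_iff)
  qed
  have fibre: "?E \<inter> {\<omega> \<in> space M. count_pair \<tau> \<tau>' z \<omega> = (i, j)} =
      {\<omega> \<in> space M. count_pair \<tau> \<tau>' z \<omega> = (i, j) \<and> spin z i \<omega> = u \<and> spin z j \<omega> = v}" for i j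
    by (auto simp: value_pair_def count_pair_def site_value_def)
  have diag: "prob (?E \<inter> ?C {(i, j). i = j}) = (if u = v then 1 / 2 else 0) * prob (?C {(i, j). i = j})"
  proof (intro prob_constant_ratio_on_fibres E)
    fix k assume "k \<in> {(i :: nat, j). i = j}"
    then obtain i where k: "k = (i, i)"
      by auto
    show "prob (?E \<inter> {\<omega> \<in> space M. count_pair \<tau> \<tau>' z \<omega> = k}) =
        (if u = v then 1 / 2 else 0) * prob {\<omega> \<in> space M. count_pair \<tau> \<tau>' z \<omega> = k}"
      unfolding k fibre prob_counts_and_spins[OF z uv] by simp
  qed auto
  have off: "prob (?E \<inter> ?C {(i, j). i \<noteq> j}) = 1 / 4 * prob (?C {(i, j). i \<noteq> j})"
  proof (intro prob_constant_ratio_on_fibres E)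
    fix k assume "k \<in> {(i :: nat, j). i \<noteq> j}"
    then obtain i j where k: "k = (i, j)" "i \<noteq> j"
      by auto
    show "prob (?E \<inter> {\<omega> \<in> space M. count_pair \<tau> \<tau>' z \<omega> = k}) =
        1 / 4 * prob {\<omega> \<in> space M. count_pair \<tau> \<tau>' z \<omega> = k}"
      unfolding k(1) fibre prob_counts_and_spins[OF z uv] using k(2) by simp
  qed auto
  have C: "?C K \<in> events" for K
    by measurable
  have "prob ?E = prob (?E \<inter> ?C {(i, j). i = j}) + prob (?E \<inter> ?C {(i, j). i \<noteq> j})"
    using E C by (subst finite_measure_Union[symmetric]) (auto intro!: arg_cong[where f = prob])
  moreover have "prob (?C {(i, j). i \<noteq> j}) = 1 - prob (?C {(i, j). i = j})"
    using C by (subst prob_compl[symmetric]) (auto intro!: arg_cong[where f = prob])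
  moreover have "prob (?C {(i, j). i = j}) = overlap \<tau> \<tau>' z"
    by (simp add: overlap_def case_prod_beta)
  ultimately show ?thesis
    using diag off by (simp add: field_simps)
qed

section \<open>Almost sure regularity of the clocks\<close>

lemma AE_gap_pos:
  assumes z: "z \<in> even_lattice"
  shows "AE \<omega> in M. \<forall>n. 0 < gap z n \<omega>"
proof (subst AE_all_countable, rule allI)
  fix n
  note [measurable] = measurable_gap[OF z]
  have "prob {\<omega> \<in> space M. 0 < gap z n \<omega>} = 1"
    using exponential_distributedD_gt[OF gap_exponential[OF z], of 0 n] by simp
  then show "AE \<omega> in M. 0 < gap z n \<omega>"
    by (subst (asm) prob_Collect_eq_1) auto
qed

text \<open>By independence the first \<open>k\<close> gaps are all at most 1 with probability
  \<open>(1 - exp (- 1)) ^ k\<close>, which tends to 0.\<close>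

lemma AE_gap_unbounded:
  assumes z: "z \<in> even_lattice"
  shows "AE \<omega> in M. \<exists>n. 1 < gap z n \<omega>"
proof -
  note [measurable] = measurable_gap[OF z]
  let ?N = "{\<omega> \<in> space M. \<forall>n. gap z n \<omega> \<le> 1}"
  let ?x = "1 - exp (- 1 :: real)"
  have bound: "prob ?N \<le> ?x ^ k" if "0 < k" for k
  proof -
    let ?J = "(\<lambda>n. Inl (z, n)) ` {..<k}"
    have "prob ?N \<le> prob (\<Inter>i\<in>?J. draws i -` {..1} \<inter> space M)"
    proof (rule finite_measure_mono)
      show "(\<Inter>i\<in>?J. draws i -` {..1} \<inter> space M) \<in> events"
        using that by (intro sets.finite_INT) auto
    qed (use that in auto)
    also have "\<dots> = (\<Prod>i\<in>?J. prob (draws i -` {..1} \<inter> space M))"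
      using z that by (intro indep_varsD[OF indep_draws]) auto
    also have "\<dots> = (\<Prod>n<k. prob (gap z n -` {..1} \<inter> space M))"
      by (subst prod.reindex) (auto simp: inj_on_def)
    also have "\<dots> = (\<Prod>n<k. ?x)"
      using exponential_distributedD_le[OF gap_exponential[OF z], of 1]
      by (intro prod.cong refl) (simp add: vimage_def Int_def conj_commute)
    finally show ?thesis
      by simp
  qed
  have "(\<lambda>k. ?x ^ k) \<longlonglongrightarrow> 0"
    by (intro LIMSEQ_power_zero) simp
  then have "prob ?N \<le> 0"
    using bound by (intro LIMSEQ_le_const) (auto intro: exI[of _ 1])
  then have "prob ?N = 0"
    by (simp add: measure_le_0_iff)
  then have "AE \<omega> in M. \<not> (\<forall>n. gap z n \<omega> \<le> 1)"
    by (subst (asm) prob_Collect_eq_0) auto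
  then show ?thesis
    by (simp add: not_le)
qed

lemma AE_finite_rings:
  "AE \<omega> in M. \<forall>z\<in>even_lattice. (\<forall>n. 0 < gap z n \<omega>) \<and> finite {n. ring_time (\<lambda>n. gap z n \<omega>) n \<le> 1}"
proof (subst AE_ball_countable)
  show "\<forall>z\<in>even_lattice. AE \<omega> in M. (\<forall>n. 0 < gap z n \<omega>) \<and> finite {n. ring_time (\<lambda>n. gap z n \<omega>) n \<le> 1}"
  proof
    fix z assume "z \<in> even_lattice"
    from AE_gap_pos[OF this] AE_gap_unbounded[OF this]
    show "AE \<omega> in M. (\<forall>n. 0 < gap z n \<omega>) \<and> finite {n. ring_time (\<lambda>n. gap z n \<omega>) n \<le> 1}"
    proof eventually_elim
      case (elim \<omega>)
      then show ?case
        using finite_rings[of "\<lambda>n. gap z n \<omega>"] by blast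
    qed
  qed
qed simp

text \<open>If the first ring falls after \<open>\<tau>\<close> and not after
  \<open>\<tau>'\<close>, the counts differ: one is zero, the other is not. This has probability
  \<open>exp (- \<tau>) - exp (- \<tau>')\<close>, which is bounded below by means of
  \<open>1 + x \<le> exp x\<close>.\<close>

lemma overlap_bound:
  assumes z: "z \<in> even_lattice" and \<tau>: "0 \<le> \<tau>" "\<tau> \<le> \<tau>'" "\<tau>' \<le> 1"
  shows "exp (- 1) * (\<tau>' - \<tau>) \<le> 1 - overlap \<tau> \<tau>' z"
proof -
  note [measurable] = measurable_count_pair[OF z, of \<tau> \<tau>'] measurable_gap[OF z]
  have E: "{\<omega> \<in> space M. fst (count_pair \<tau> \<tau>' z \<omega>) = snd (count_pair \<tau> \<tau>' z \<omega>)} \<in> events"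
  proof -
    have "{\<omega> \<in> space M. count_pair \<tau> \<tau>' z \<omega> \<in> {p. fst p = snd p}} \<in> events"
      by measurable
    then show ?thesis by simp
  qed
  have "exp (- 1) * (\<tau>' - \<tau>) \<le> exp (- \<tau>') * (exp (\<tau>' - \<tau>) - 1)"
  proof (intro mult_mono)
    show "\<tau>' - \<tau> \<le> exp (\<tau>' - \<tau>) - 1"
      using exp_ge_add_one_self[of "\<tau>' - \<tau>"] by linarith
  qed (use \<tau> in auto)
  also have "\<dots> = exp (- \<tau>) - exp (- \<tau>')"
    by (simp add: algebra_simps flip: exp_add)
  also have "\<dots> = prob {\<omega> \<in> space M. \<tau> < gap z 0 \<omega>} - prob {\<omega> \<in> space M. \<tau>' < gap z 0 \<omega>}"
    using exponential_distributedD_gt[OF gap_exponential[OF z], of \<tau> 0]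
      exponential_distributedD_gt[OF gap_exponential[OF z], of \<tau>' 0] \<tau> by simp
  also have "\<dots> = prob ({\<omega> \<in> space M. \<tau> < gap z 0 \<omega>} - {\<omega> \<in> space M. \<tau>' < gap z 0 \<omega>})"
    using \<tau> by (intro finite_measure_Diff[symmetric]) auto
  also have "\<dots> \<le> prob (space M - {\<omega> \<in> space M. fst (count_pair \<tau> \<tau>' z \<omega>) = snd (count_pair \<tau> \<tau>' z \<omega>)})"
  proof (rule finite_measure_mono_AE)
    show "AE \<omega> in M. \<omega> \<in> {\<omega> \<in> space M. \<tau> < gap z 0 \<omega>} - {\<omega> \<in> space M. \<tau>' < gap z 0 \<omega>} \<longrightarrow>
        \<omega> \<in> space M - {\<omega> \<in> space M. fst (count_pair \<tau> \<tau>' z \<omega>) = snd (count_pair \<tau> \<tau>' z \<omega>)}"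
      using AE_finite_rings
    proof eventually_elim
      case (elim \<omega>)
      let ?g = "\<lambda>n. gap z n \<omega>"
      have pos: "0 < ?g n" for n
        using elim z by blast
      have "fst (count_pair \<tau> \<tau>' z \<omega>) \<noteq> snd (count_pair \<tau> \<tau>' z \<omega>)" if "\<tau> < ?g 0" "?g 0 \<le> \<tau>'"
      proof -
        have "?g 0 \<le> ring_time ?g n" for n
          unfolding ring_time_def using pos by (intro member_le_sum) (auto intro: less_imp_le)
        then have "{n. ring_time ?g n \<le> \<tau>} = {}"
          using that(1) by (auto simp: not_le intro: less_le_trans)
        moreover have "0 \<in> {n. ring_time ?g n \<le> \<tau>'}"
          using that(2) by (simp add: ring_time_def)
        \<comment> \<open>Without finiteness \<open>card\<close> would return 0 for this nonempty
          set as well.\<close>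
        moreover have "finite {n. ring_time ?g n \<le> \<tau>'}"
          using elim z \<tau>(3) by (auto elim!: rev_finite_subset dest: bspec)
        ultimately show ?thesis
          by (auto simp: count_pair_def ring_count_def card_eq_0_iff)
      qed
      then show ?case
        by auto
    qed
  qed (use E in auto)
  also have "\<dots> = 1 - overlap \<tau> \<tau>' z"
    unfolding overlap_def by (rule prob_compl[OF E])
  finally show ?thesis .
qed

lemma overlap_le_1: "overlap \<tau> \<tau>' z \<le> 1"
  by (simp add: overlap_def)

lemma coupled_arrows_value_pair: "coupled_arrows M (value_pair \<tau> \<tau>') (overlap \<tau> \<tau>')"
proof
  show "value_pair \<tau> \<tau>' z \<omega> \<in> {-1, 1} \<times> {-1, 1}" if "z \<in> even_lattice" "\<omega> \<in> space M" for z \<omega>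
    unfolding value_pair_def site_value_def using spin_values[OF that] by (intro SigmaI)
qed (rule indep_value_pairs value_pair_law; assumption)+

end

subsection \<open>Second moment\<close>

context dynamical_web
begin

definition walk :: "real \<Rightarrow> nat \<Rightarrow> 'a \<Rightarrow> int" where
  "walk \<tau> n \<omega> = fst (follow_arrows (\<lambda>z. \<xi> z \<tau> \<omega>) (0, 0) n)"

lemma \<xi>_sign:
  assumes "z \<in> even_lattice" "0 \<le> \<tau>" "\<omega> \<in> space M"
  shows "\<xi> z \<tau> \<omega> \<in> {-1, 1}"
  using spin_values[OF assms(1,3)] by (simp only: \<xi>_eq[OF assms] site_value_def)

text \<open>The path from the origin never leaves the lattice, so the values of \<open>a\<close>
  elsewhere are arbitrary.\<close>

lemma walk_eq:
  assumes "\<omega> \<in> space M" "0 \<le> \<tau>"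
    and "\<And>z. z \<in> even_lattice \<Longrightarrow> a z = site_value (\<lambda>n. gap z n \<omega>) (\<lambda>n. spin z n \<omega>) \<tau>"
  shows "fst (follow_arrows a (0, 0) n) = walk \<tau> n \<omega>"
proof -
  have "follow_arrows (\<lambda>z. \<xi> z \<tau> \<omega>) (0, 0) n = follow_arrows a (0, 0) n"
  proof (rule follow_arrows_cong)
    fix j
    let ?z = "follow_arrows (\<lambda>z. \<xi> z \<tau> \<omega>) (0, 0) j"
    have "?z \<in> even_lattice"
      by (intro follow_arrows_lattice \<xi>_sign assms)
    then show "\<xi> ?z \<tau> \<omega> = a ?z"
      using assms by (simp only: \<xi>_eq)
  qed
  then show ?thesis
    by (simp add: walk_def)
qed

lemma walk_pair_eq:
  assumes "\<omega> \<in> space M" "0 \<le> \<tau>" "0 \<le> \<tau>'"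
  shows "arrow_pairs.walk1 (value_pair \<tau> \<tau>') n \<omega> = walk \<tau> n \<omega>"
    and "arrow_pairs.walk2 (value_pair \<tau> \<tau>') n \<omega> = walk \<tau>' n \<omega>"
proof -
  interpret coupled_arrows M "value_pair \<tau> \<tau>'" "overlap \<tau> \<tau>'"
    by (rule coupled_arrows_value_pair)
  show "walk1 n \<omega> = walk \<tau> n \<omega>" "walk2 n \<omega> = walk \<tau>' n \<omega>"
    unfolding walk1_def walk2_def using assms by (simp_all add: walk_eq value_pair_def)
qed

lemma integrable_walks:
  fixes H :: "int \<Rightarrow> int \<Rightarrow> real"
  assumes "0 \<le> \<tau>" "0 \<le> \<tau>'"
  shows "integrable M (\<lambda>\<omega>. H (walk \<tau> n \<omega>) (walk \<tau>' n \<omega>))"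
proof -
  interpret coupled_arrows M "value_pair \<tau> \<tau>'" "overlap \<tau> \<tau>'"
    by (rule coupled_arrows_value_pair)
  show ?thesis
    using bounded_walk_integrable[of H n] assms
    by (subst Bochner_Integration.integrable_cong[OF refl, of _ _ "\<lambda>\<omega>. H (walk1 n \<omega>) (walk2 n \<omega>)"])
       (simp_all add: walk_pair_eq)
qed

lemma measurable_walk:
  assumes "0 \<le> \<tau>"
  shows "walk \<tau> n \<in> measurable M (count_space UNIV)"
proof -
  \<comment> \<open>A single walk is handled as a degenerate pair with equal dynamical
    times.\<close>
  interpret coupled_arrows M "value_pair \<tau> \<tau>" "overlap \<tau> \<tau>"
    by (rule coupled_arrows_value_pair)
  show ?thesis
    using measurable_walk(1)[of n] assms
    by (subst measurable_cong[of _ _ "walk1 n"]) (simp_all add: walk_pair_eq)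
qed

lemma expectation_exp_walk:
  assumes "0 \<le> \<tau>"
  shows "expectation (\<lambda>\<omega>. exp (l * real_of_int (walk \<tau> n \<omega>))) = cosh l ^ n"
proof -
  interpret coupled_arrows M "value_pair \<tau> \<tau>" "overlap \<tau> \<tau>"
    by (rule coupled_arrows_value_pair)
  have "expectation (\<lambda>\<omega>. exp (l * real_of_int (walk \<tau> n \<omega>))) =
      expectation (\<lambda>\<omega>. exp (l * real_of_int (walk1 n \<omega>)))"
    using assms by (intro Bochner_Integration.integral_cong refl) (simp add: walk_pair_eq)
  then show ?thesis
    by (simp add: expectation_exp_walk1)
qed

text \<open>Only a lower bound \<open>\<delta>\<close> on the separation enters, so that one choice
  of \<open>\<kappa>\<close> and \<open>\<mu>\<close> serves all pairs of sampled times.\<close>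

lemma expectation_exp_walks:
  assumes \<tau>: "0 \<le> \<tau>" "\<tau>' \<le> 1" "0 \<le> \<delta>" "\<delta> \<le> \<tau>' - \<tau>" and \<kappa>: "0 \<le> \<kappa>" and \<mu>: "0 \<le> \<mu>"
    and meeting: "2 * (sinh l)\<^sup>2 * (1 + \<kappa>) \<le> exp (- 1) * \<delta> * \<kappa> * (1 - exp (- (2 * \<mu>)))"
  shows "expectation (\<lambda>\<omega>. exp (l * real_of_int (walk \<tau> n \<omega> + walk \<tau>' n \<omega>)))
    \<le> (cosh l) ^ (2 * n) * (1 + \<kappa> * (sinh \<mu>)\<^sup>2) ^ n * (1 + \<kappa>)"
proof -
  interpret coupled_arrows M "value_pair \<tau> \<tau>'" "overlap \<tau> \<tau>'"
    by (rule coupled_arrows_value_pair)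
  have "expectation (\<lambda>\<omega>. exp (l * real_of_int (walk \<tau> n \<omega> + walk \<tau>' n \<omega>))) =
      expectation (\<lambda>\<omega>. exp (l * real_of_int (walk1 n \<omega> + walk2 n \<omega>)))"
    using \<tau> by (intro Bochner_Integration.integral_cong refl) (simp add: walk_pair_eq)
  also have "\<dots> \<le> (cosh l) ^ (2 * n) * (1 + \<kappa> * (sinh \<mu>)\<^sup>2) ^ n * (1 + \<kappa>)"
  proof (rule expectation_exp_pair[OF \<kappa> \<mu>])
    fix z :: "int \<times> int" assume z: "z \<in> even_lattice"
    have "exp (- 1) * \<delta> \<le> exp (- 1) * (\<tau>' - \<tau>)"
      using \<tau> by simp
    also have "\<dots> \<le> 1 - overlap \<tau> \<tau>' z"
      using \<tau> by (intro overlap_bound[OF z]) auto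
    finally have "exp (- 1) * \<delta> * \<kappa> * (1 - exp (- (2 * \<mu>))) \<le> (1 - overlap \<tau> \<tau>' z) * \<kappa> * (1 - exp (- (2 * \<mu>)))"
      using \<kappa> \<mu> by (intro mult_right_mono) auto
    with meeting show "2 * (sinh l)\<^sup>2 * (1 + \<kappa>) \<le> (1 - overlap \<tau> \<tau>' z) * \<kappa> * (1 - exp (- (2 * \<mu>)))"
      by linarith
  qed (rule overlap_le_1)
  finally show ?thesis .
qed

text \<open>The second moment method for the average \<open>Z\<close> of the normalised
  exponentials, which has mean 1. If all of them are below \<open>1 / 2\<close>, then
  \<open>(1 - Z)\<^sup>2\<close> is at least \<open>1 / 4\<close>, so Chebyshev's bound gives four
  times the variance. In the second moment the diagonal contributes the first term and the distinct
  pairs the product with \<open>\<kappa>\<close>.\<close>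

lemma prob_all_walks_small:
  fixes T :: "nat \<Rightarrow> real"
  assumes m: "0 < m" and T: "\<And>i. i < m \<Longrightarrow> T i \<in> {0..1}" "\<And>i j. i < j \<Longrightarrow> j < m \<Longrightarrow> \<delta> \<le> T j - T i"
    and \<delta>: "0 \<le> \<delta>" and \<kappa>: "0 \<le> \<kappa>" and \<mu>: "0 \<le> \<mu>"
    and meeting: "2 * (sinh l)\<^sup>2 * (1 + \<kappa>) \<le> exp (- 1) * \<delta> * \<kappa> * (1 - exp (- (2 * \<mu>)))"
  shows "prob {\<omega> \<in> space M. \<forall>i<m. exp (l * real_of_int (walk (T i) n \<omega>)) < cosh l ^ n / 2} \<le>
    4 * ((cosh (2 * l) / (cosh l)\<^sup>2) ^ n / real m + (1 + \<kappa> * (sinh \<mu>)\<^sup>2) ^ n * (1 + \<kappa>) - 1)"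
proof -
  let ?c = "cosh l ^ n"
  let ?R = "(1 + \<kappa> * (sinh \<mu>)\<^sup>2) ^ n * (1 + \<kappa>)"
  let ?Q = "(cosh (2 * l) / (cosh l)\<^sup>2) ^ n"
  define e where "e i \<omega> = exp (l * real_of_int (walk (T i) n \<omega>)) / ?c" for i \<omega>
  define Z where "Z \<omega> = (\<Sum>i<m. e i \<omega>) / real m" for \<omega>
  have c: "0 < ?c"
    by simp
  have R: "0 \<le> ?R"
    using \<kappa> by simp
  have int1: "integrable M (e i)" if "i < m" for i
    using integrable_walks[of "T i" "T i" "\<lambda>x y. exp (l * real_of_int x) / ?c" n] T(1)[OF that]
    by (simp add: e_def[abs_def])
  have int2: "integrable M (\<lambda>\<omega>. e i \<omega> * e j \<omega>)" if "i < m" "j < m" for i j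
    using integrable_walks[of "T i" "T j" "\<lambda>x y. exp (l * real_of_int x) / ?c * (exp (l * real_of_int y) / ?c)" n]
      T(1)[OF that(1)] T(1)[OF that(2)]
    by (simp add: e_def[abs_def])
  have Ee: "expectation (e i) = 1" if "i < m" for i
    using expectation_exp_walk[of "T i" l n] T(1)[OF that] by (simp add: e_def[abs_def])
  have ee: "expectation (\<lambda>\<omega>. e i \<omega> * e j \<omega>) =
      expectation (\<lambda>\<omega>. exp (l * real_of_int (walk (T i) n \<omega> + walk (T j) n \<omega>))) / (cosh l) ^ (2 * n)" for i j
    by (simp add: e_def distrib_left exp_add power_mult power2_eq_square power_mult_distrib)
  have off: "expectation (\<lambda>\<omega>. e i \<omega> * e j \<omega>) \<le> ?R" if "i < j" "j < m" for i j
  proof -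
    have "expectation (\<lambda>\<omega>. exp (l * real_of_int (walk (T i) n \<omega> + walk (T j) n \<omega>))) \<le>
        (cosh l) ^ (2 * n) * (1 + \<kappa> * (sinh \<mu>)\<^sup>2) ^ n * (1 + \<kappa>)"
      using T(1)[of i] T(1)[of j] T(2)[OF that] that by (intro expectation_exp_walks[OF _ _ \<delta> _ \<kappa> \<mu> meeting]) auto
    then show ?thesis
      unfolding ee by (simp add: divide_le_eq mult_ac)
  qed
  have diag: "expectation (\<lambda>\<omega>. e i \<omega> * e i \<omega>) = ?Q" if "i < m" for i
    using expectation_exp_walk[of "T i" "2 * l" n] T(1)[OF that]
    unfolding ee power_mult[of "cosh l" 2] by (simp add: power_divide algebra_simps)
  \<comment> \<open>Adding the non-negative \<open>?R\<close> on the diagonal too makes the double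
    sum easy to evaluate.\<close>
  have pair: "expectation (\<lambda>\<omega>. e i \<omega> * e j \<omega>) \<le> (if i = j then ?Q else 0) + ?R" if "i < m" "j < m" for i j
    using off[of i j] off[of j i] diag[of i] that R by (cases i j rule: linorder_cases) (auto simp: mult.commute)
  have Z2: "(Z \<omega>)\<^sup>2 = (\<Sum>i<m. \<Sum>j<m. e i \<omega> * e j \<omega>) / (real m)\<^sup>2" for \<omega>
    by (simp add: Z_def power_divide power2_eq_square sum_product)
  have intZ: "integrable M Z"
    unfolding Z_def using int1 by (intro integrable_divide_zero Bochner_Integration.integrable_sum) auto
  have intZ2: "integrable M (\<lambda>\<omega>. (Z \<omega>)\<^sup>2)"
    unfolding Z2 using int2 by (intro integrable_divide_zero Bochner_Integration.integrable_sum) auto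
  have EZ: "expectation Z = 1"
    unfolding Z_def using int1 m by (simp add: Bochner_Integration.integral_sum Ee)
  have "expectation (\<lambda>\<omega>. (Z \<omega>)\<^sup>2) = (\<Sum>i<m. \<Sum>j<m. expectation (\<lambda>\<omega>. e i \<omega> * e j \<omega>)) / (real m)\<^sup>2"
  proof -
    have "expectation (\<lambda>\<omega>. \<Sum>i<m. \<Sum>j<m. e i \<omega> * e j \<omega>) =
        (\<Sum>i<m. expectation (\<lambda>\<omega>. \<Sum>j<m. e i \<omega> * e j \<omega>))"
      using int2 by (intro Bochner_Integration.integral_sum Bochner_Integration.integrable_sum) auto
    also have "\<dots> = (\<Sum>i<m. \<Sum>j<m. expectation (\<lambda>\<omega>. e i \<omega> * e j \<omega>))"
      using int2 by (intro sum.cong refl Bochner_Integration.integral_sum) auto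
    finally show ?thesis
      by (simp add: Z2)
  qed
  also have "\<dots> \<le> (\<Sum>i<m. \<Sum>j<m. (if i = j then ?Q else 0) + ?R) / (real m)\<^sup>2"
    using pair by (intro divide_right_mono sum_mono) auto
  also have "\<dots> = ?Q / real m + ?R"
    using m by (simp add: sum.distrib field_simps power2_eq_square)
  finally have EZ2: "expectation (\<lambda>\<omega>. (Z \<omega>)\<^sup>2) \<le> ?Q / real m + ?R" .
  define A where "A = {\<omega> \<in> space M. \<forall>i<m. exp (l * real_of_int (walk (T i) n \<omega>)) < ?c / 2}"
  have A: "A \<in> events"
  proof -
    have "{\<omega> \<in> space M. i < m \<longrightarrow> exp (l * real_of_int (walk (T i) n \<omega>)) < ?c / 2} \<in> events" for i
    proof (cases "i < m")
      case True
      then have [measurable]: "walk (T i) n \<in> measurable M (count_space UNIV)"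
        using T(1)[of i] by (intro measurable_walk) auto
      show ?thesis
        by measurable
    qed simp
    then show ?thesis
      unfolding A_def by (rule sets.sets_Collect_countable_All)
  qed
  have "prob A = expectation (indicator A)"
    using A by (simp add: sets.Int_space_eq2)
  also have "\<dots> \<le> expectation (\<lambda>\<omega>. 4 * (1 - 2 * Z \<omega> + (Z \<omega>)\<^sup>2))"
  proof (rule integral_mono)
    show "integrable M (\<lambda>\<omega>. 4 * (1 - 2 * Z \<omega> + (Z \<omega>)\<^sup>2))"
      using intZ intZ2 by simp
    show "integrable M (indicator A :: 'a \<Rightarrow> real)"
      using A by (simp add: less_top[symmetric])
    fix \<omega>
    \<comment> \<open>The expanded form serves linearity of the expectation, the square serves the
      pointwise bound.\<close>
    have sq: "4 * (1 - 2 * Z \<omega> + (Z \<omega>)\<^sup>2) = 4 * (1 - Z \<omega>)\<^sup>2"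
      by (simp add: power2_eq_square algebra_simps)
    show "indicator A \<omega> \<le> 4 * (1 - 2 * Z \<omega> + (Z \<omega>)\<^sup>2)"
    proof (cases "\<omega> \<in> A")
      case True
      then have "e i \<omega> \<le> 1 / 2" if "i < m" for i
        using that c by (auto simp: A_def e_def divide_le_eq intro: less_imp_le)
      then have "(\<Sum>i<m. e i \<omega>) \<le> real m * (1 / 2)"
        using sum_bounded_above[of "{..<m}" "\<lambda>i. e i \<omega>" "1 / 2"] by simp
      then have "Z \<omega> \<le> 1 / 2"
        using m by (simp add: Z_def divide_le_eq)
      then have "(1 / 2)\<^sup>2 \<le> (1 - Z \<omega>)\<^sup>2"
        by (intro power_mono) auto
      then show ?thesis
        unfolding sq using True by (simp add: power2_eq_square)
    next
      case False
      then show ?thesis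
        unfolding sq by simp
    qed
  qed
  also have "\<dots> = 4 * (expectation (\<lambda>\<omega>. (Z \<omega>)\<^sup>2) - 1)"
    using intZ intZ2 by (simp add: EZ prob_space)
  also have "\<dots> \<le> 4 * (?Q / real m + ?R - 1)"
    using EZ2 by (intro mult_left_mono diff_right_mono) auto
  finally show ?thesis
    unfolding A_def .
qed

end

text \<open>
  With this tilt \<open>(tilt m)\<^sup>2 * m ^ 4 = ln m / 4\<close>, small enough for the diagonal terms of the second
  moment, of order \<open>m powr (1 / 4) / m\<close>, to vanish.
\<close>

definition tilt :: "nat \<Rightarrow> real" where
  "tilt m = sqrt (ln (real m)) / (2 * real m ^ 2)"

text \<open>The choice of \<open>\<kappa>\<close> for \<open>\<delta> = d / real m\<close> and
  \<open>\<mu> = 1 / real m ^ 2\<close>: it solves \<open>meeting\<close> with equality after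
  \<open>1 + \<kappa>\<close> is replaced by 2. Its order is \<open>ln m / m\<close>. Since
  \<open>(sinh \<mu>)\<^sup>2\<close> is of order \<open>1 / m ^ 4\<close>, the error accumulated
  over \<open>m ^ 4\<close> steps vanishes with it.\<close>

definition meeting_weight :: "real \<Rightarrow> nat \<Rightarrow> real" where
  "meeting_weight d m = 4 * (sinh (tilt m))\<^sup>2 / (exp (- 1) * (d / real m) * (1 - exp (- (2 / real m ^ 2))))"

text \<open>The bound of \<open>prob_all_walks_small\<close> for \<open>m\<close> sampled times at
  spacing \<open>d / real m\<close> and a walk of \<open>m ^ 4\<close> steps.\<close>

definition failure_bound :: "real \<Rightarrow> nat \<Rightarrow> real" where
  "failure_bound d m = 4 * ((cosh (2 * tilt m) / (cosh (tilt m))\<^sup>2) ^ (m ^ 4) / real m +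
     (1 + meeting_weight d m * (sinh (1 / real m ^ 2))\<^sup>2) ^ (m ^ 4) * (1 + meeting_weight d m) - 1)"

lemma meeting_weight_tendsto:
  assumes "0 < d"
  shows "(meeting_weight d) \<longlonglongrightarrow> 0"
  unfolding meeting_weight_def tilt_def using assms by real_asymp

text \<open>The ratio inside the power is \<open>1 + (tanh l)\<^sup>2\<close>, at most
  \<open>exp ((sinh l)\<^sup>2)\<close> with \<open>l = tilt m\<close>. As
  \<open>m ^ 4 * (sinh l)\<^sup>2\<close> is asymptotic to \<open>ln m / 4\<close>, it is eventually
  at most \<open>ln m / 2\<close>, and the power is at most the square root of
  \<open>m\<close>.\<close>

lemma diagonal_tendsto:
  "(\<lambda>m. (cosh (2 * tilt m) / (cosh (tilt m))\<^sup>2) ^ (m ^ 4) / real m) \<longlonglongrightarrow> 0"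
proof (rule tendsto_sandwich[where f = "\<lambda>_. 0" and h = "\<lambda>m. exp (ln (real m) / 2) / real m"])
  have "(\<lambda>m. real m ^ 4 * (sinh (tilt m))\<^sup>2 / ln (real m)) \<longlonglongrightarrow> (1 / 2)\<^sup>2"
    unfolding tilt_def by real_asymp
  then have "\<forall>\<^sub>F m in sequentially. real m ^ 4 * (sinh (tilt m))\<^sup>2 / ln (real m) < 1 / 2"
    by (rule order_tendstoD) (simp add: power2_eq_square)
  moreover have "\<forall>\<^sub>F m in sequentially. 0 < ln (real m)"
    by real_asymp
  ultimately have "\<forall>\<^sub>F m in sequentially. real (m ^ 4) * (sinh (tilt m))\<^sup>2 \<le> ln (real m) / 2"
    by eventually_elim (simp add: divide_less_eq)
  then show "\<forall>\<^sub>F m in sequentially. (cosh (2 * tilt m) / (cosh (tilt m))\<^sup>2) ^ (m ^ 4) / real m \<le>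
      exp (ln (real m) / 2) / real m"
  proof eventually_elim
    case (elim m)
    let ?c = "(cosh (tilt m))\<^sup>2" and ?s = "(sinh (tilt m))\<^sup>2"
    have "cosh (2 * tilt m) / ?c = 1 + ?s / ?c"
      by (simp add: cosh_double add_divide_distrib)
    also have "\<dots> \<le> 1 + ?s"
      using one_le_power[OF cosh_real_ge_1[of "tilt m"], of 2]
      by (simp add: divide_le_eq mult_le_cancel_left1)
    also have "\<dots> \<le> exp ?s"
      by (rule exp_ge_add_one_self)
    finally have "(cosh (2 * tilt m) / ?c) ^ (m ^ 4) \<le> exp ?s ^ (m ^ 4)"
      by (intro power_mono) auto
    also have "\<dots> = exp (real (m ^ 4) * ?s)"
      by (rule exp_of_nat_mult[symmetric])
    also have "\<dots> \<le> exp (ln (real m) / 2)"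
      using elim by simp
    finally show ?case
      by (intro divide_right_mono) auto
  qed
  show "(\<lambda>m. exp (ln (real m) / 2) / real m) \<longlonglongrightarrow> 0"
    by real_asymp
qed auto

lemma failure_bound_tendsto:
  assumes "0 < d"
  shows "(failure_bound d) \<longlonglongrightarrow> 0"
proof -
  have "(\<lambda>m. (cosh (2 * tilt m) / (cosh (tilt m))\<^sup>2) ^ (m ^ 4) / real m) \<longlonglongrightarrow> 0"
    by (rule diagonal_tendsto)
  moreover have "(\<lambda>m. (1 + meeting_weight d m * (sinh (1 / real m ^ 2))\<^sup>2) ^ (m ^ 4)) \<longlonglongrightarrow> 1"
    unfolding meeting_weight_def tilt_def using assms by real_asymp
  moreover note meeting_weight_tendsto[OF assms]
  ultimately have "(failure_bound d) \<longlonglongrightarrow> 4 * (0 + 1 * (1 + 0) - 1)"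
    unfolding failure_bound_def by (intro tendsto_intros)
  then show ?thesis
    by simp
qed

text \<open>For large \<open>m\<close> the left side equals \<open>ln m / 10\<close>, while the
  right side is asymptotic to \<open>ln m / 8\<close>, because \<open>ln (cosh l)\<close> behaves
  like \<open>l\<^sup>2 / 2\<close>. The constant \<open>1 / 10\<close> is chosen below
  \<open>1 / 8\<close>.\<close>

lemma tilt_growth:
  "\<forall>\<^sub>F m in sequentially. 1 / 10 * sqrt (real (m ^ 4) * ln (real (m ^ 4))) * tilt m \<le>
     real (m ^ 4) * ln (cosh (tilt m)) - ln 2"
  unfolding tilt_def by real_asymp

subsection \<open>Exceptional times\<close>

definition threshold :: "nat \<Rightarrow> real" where
  "threshold m = 1 / 10 * sqrt (real (m ^ 4) * ln (real (m ^ 4)))"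

context dynamical_web
begin

text \<open>The sign \<open>s\<close> covers large positive and large negative positions at once;
  \<open>m\<close> indexes the walk time \<open>m ^ 4\<close>.\<close>

definition large_at :: "real \<Rightarrow> 'a \<Rightarrow> real \<Rightarrow> nat \<Rightarrow> bool" where
  "large_at s \<omega> \<tau> m \<longleftrightarrow> threshold m \<le> s * real_of_int (walk \<tau> (m ^ 4) \<omega>)"

lemma measurable_large_at:
  assumes "0 \<le> \<tau>"
  shows "{\<omega> \<in> space M. large_at s \<omega> \<tau> m} \<in> events"
proof -
  note [measurable] = measurable_walk[OF assms]
  show ?thesis
    unfolding large_at_def by measurable
qed

text \<open>At \<open>m\<close> equally spaced dynamical times of the interval, all positions fail
  to be large with probability at most \<open>failure_bound d m\<close> for large \<open>m\<close>.
  This tends to 0, so failure for all \<open>m \<ge> N\<close> is a null event. Since the interval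
  is arbitrary, large positions occur at a dense set of dynamical times.\<close>

lemma AE_large_at:
  assumes ab: "0 \<le> a" "a < b" "b \<le> 1" and s: "s \<in> {-1, 1}"
  shows "AE \<omega> in M. \<exists>m\<ge>N. \<exists>\<tau>\<in>{a..<b}. large_at s \<omega> \<tau> m"
proof -
  define d where "d = b - a"
  have d: "0 < d"
    using ab by (simp add: d_def)
  define T where "T m i = a + real i * (d / real m)" for m i :: nat
  have T: "T m i \<in> {a..<b}" if "i < m" for m i
  proof -
    have "real i * (d / real m) < real m * (d / real m)"
      using that d by (intro mult_strict_right_mono) auto
    then show ?thesis
      using that d by (auto simp: T_def d_def)
  qed
  have T01: "T m i \<in> {0..1}" if "i < m" for m i
    using T[OF that] ab by auto
  define B where "B m = {\<omega> \<in> space M. \<forall>i<m. \<not> large_at s \<omega> (T m i) m}" for m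
  have B: "B m \<in> events" for m
  proof -
    have "{\<omega> \<in> space M. i < m \<longrightarrow> \<not> large_at s \<omega> (T m i) m} \<in> events" for i
      using measurable_large_at[of "T m i" s m] T01[of i m]
      by (cases "i < m") (auto intro: sets.sets_Collect_neg)
    then show ?thesis
      unfolding B_def by (rule sets.sets_Collect_countable_All)
  qed
  have "\<forall>\<^sub>F m in sequentially. prob (B m) \<le> failure_bound d m"
  proof -
    have "\<forall>\<^sub>F m in sequentially. meeting_weight d m < 1"
      using meeting_weight_tendsto[OF d] by (rule order_tendstoD) simp
    then show ?thesis
      using tilt_growth eventually_gt_at_top[of 1]
    proof eventually_elim
      case (elim m)
      let ?l = "tilt m" and ?\<kappa> = "meeting_weight d m" and ?n = "m ^ 4"
      let ?D = "exp (- 1) * (d / real m) * (1 - exp (- (2 / real m ^ 2)))"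
      have l: "0 < ?l"
        using elim(3) by (simp add: tilt_def)
      have D: "0 < ?D"
        using elim(3) d by simp
      have \<kappa>: "0 \<le> ?\<kappa>"
        using D unfolding meeting_weight_def by (intro divide_nonneg_pos) auto
      \<comment> \<open>Here the weight is below 1, which justifies the factor 4 in
        \<open>meeting_weight\<close>.\<close>
      have "2 * (sinh ?l)\<^sup>2 * (1 + ?\<kappa>) \<le> 2 * (sinh ?l)\<^sup>2 * 2"
        using elim(1) by (intro mult_left_mono) auto
      also have "\<dots> = ?D * ?\<kappa>"
      proof -
        have "y * (x / y) = x" if "0 < y" for x y :: real
          using that by simp
        from this[OF D] show ?thesis
          unfolding meeting_weight_def by simp
      qed
      finally have meeting: "2 * (sinh (s * ?l))\<^sup>2 * (1 + ?\<kappa>) \<le>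
          exp (- 1) * (d / real m) * ?\<kappa> * (1 - exp (- (2 * (1 / real m ^ 2))))"
        using s by (auto simp: mult_ac)
      \<comment> \<open>The sign enters as a tilt by \<open>s * ?l\<close>; all bounds are even in
        the tilt.\<close>
      have even: "cosh (s * ?l) = cosh ?l" "cosh (2 * (s * ?l)) = cosh (2 * ?l)" "sinh (s * ?l) ^ 2 = sinh ?l ^ 2"
        using s by auto
      have "prob (B m) \<le> prob {\<omega> \<in> space M. \<forall>i<m. exp (s * ?l * real_of_int (walk (T m i) ?n \<omega>)) < cosh (s * ?l) ^ ?n / 2}"
      proof (rule finite_measure_mono)
        show "{\<omega> \<in> space M. \<forall>i<m. exp (s * ?l * real_of_int (walk (T m i) ?n \<omega>)) < cosh (s * ?l) ^ ?n / 2} \<in> events"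
        proof -
          have "{\<omega> \<in> space M. i < m \<longrightarrow> exp (s * ?l * real_of_int (walk (T m i) ?n \<omega>)) < cosh (s * ?l) ^ ?n / 2} \<in> events" for i
          proof (cases "i < m")
            case True
            then have [measurable]: "walk (T m i) ?n \<in> measurable M (count_space UNIV)"
              using T01[of i m] by (intro measurable_walk) auto
            show ?thesis
              by measurable
          qed simp
          then show ?thesis
            by (rule sets.sets_Collect_countable_All)
        qed
        show "B m \<subseteq> {\<omega> \<in> space M. \<forall>i<m. exp (s * ?l * real_of_int (walk (T m i) ?n \<omega>)) < cosh (s * ?l) ^ ?n / 2}"
        proof
          fix \<omega> assume \<omega>: "\<omega> \<in> B m"
          have "exp (s * ?l * real_of_int (walk (T m i) ?n \<omega>)) < cosh (s * ?l) ^ ?n / 2" if "i < m" for i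
          proof -
            \<comment> \<open>Below the threshold, \<open>tilt_growth\<close> keeps the exponential
              under half of its mean.\<close>
            have "s * real_of_int (walk (T m i) ?n \<omega>) < threshold m"
              using \<omega> that by (auto simp: B_def large_at_def not_le)
            then have "s * real_of_int (walk (T m i) ?n \<omega>) * ?l < threshold m * ?l"
              using l by (rule mult_strict_right_mono)
            also have "\<dots> \<le> real ?n * ln (cosh ?l) - ln 2"
              using elim(2) by (simp only: threshold_def)
            also have "\<dots> = ln (cosh ?l ^ ?n / 2)"
              by (simp add: ln_div ln_realpow)
            finally have "exp (s * real_of_int (walk (T m i) ?n \<omega>) * ?l) < exp (ln (cosh ?l ^ ?n / 2))"
              by (simp only: exp_less_cancel_iff)
            also have "\<dots> = cosh ?l ^ ?n / 2"
              by (rule exp_ln) simp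
            finally show ?thesis
              unfolding even by (simp only: mult_ac)
          qed
          then show "\<omega> \<in> {\<omega> \<in> space M. \<forall>i<m. exp (s * ?l * real_of_int (walk (T m i) ?n \<omega>)) < cosh (s * ?l) ^ ?n / 2}"
            using \<omega> by (simp add: B_def)
        qed
      qed
      also have "\<dots> \<le> 4 * ((cosh (2 * (s * ?l)) / (cosh (s * ?l))\<^sup>2) ^ ?n / real m +
          (1 + ?\<kappa> * (sinh (1 / real m ^ 2))\<^sup>2) ^ ?n * (1 + ?\<kappa>) - 1)"
      proof (rule prob_all_walks_small[OF _ T01 _ _ \<kappa> _ meeting])
        show "d / real m \<le> T m j - T m i" if "i < j" for i j
        proof -
          have "1 * (d / real m) \<le> (real j - real i) * (d / real m)"
            using that d by (intro mult_right_mono) auto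
          then show ?thesis
            by (simp add: T_def left_diff_distrib diff_divide_distrib)
        qed
      qed (use elim(3) d in auto)
      also have "\<dots> = failure_bound d m"
        unfolding even failure_bound_def ..
      finally show ?case .
    qed
  qed
  moreover have "(\<lambda>m. prob (B m)) \<longlonglongrightarrow> 0" if "\<forall>\<^sub>F m in sequentially. prob (B m) \<le> failure_bound d m"
    using that by (intro tendsto_sandwich[OF _ _ tendsto_const failure_bound_tendsto[OF d]]) auto
  ultimately have lim: "(\<lambda>m. prob (B m)) \<longlonglongrightarrow> 0"
    by blast
  define A where "A = (\<Inter>m\<in>{N..}. B m)"
  have A: "A \<in> events"
    unfolding A_def using B by (intro sets.countable_INT') auto
  have "prob A \<le> prob (B m)" if "N \<le> m" for m
    using that B by (intro finite_measure_mono) (auto simp: A_def)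
  then have "prob A \<le> 0"
    by (intro LIMSEQ_le_const[OF lim]) blast
  then have "A \<in> null_sets M"
    using A by (auto simp: null_sets_def emeasure_eq_measure measure_le_0_iff)
  then show ?thesis
  proof (rule AE_I')
    show "{\<omega> \<in> space M. \<not> (\<exists>m\<ge>N. \<exists>\<tau>\<in>{a..<b}. large_at s \<omega> \<tau> m)} \<subseteq> A"
      using T by (auto simp: A_def B_def)
  qed
qed

section \<open>Right-constancy in dynamical time and the category argument\<close>

lemma walk_right_constant:
  assumes \<omega>: "\<omega> \<in> space M" and fin: "\<And>z. z \<in> even_lattice \<Longrightarrow> finite {n. ring_time (\<lambda>n. gap z n \<omega>) n \<le> 1}"
    and \<tau>: "0 \<le> \<tau>" "\<tau> < 1"
  shows "\<forall>\<^sub>F \<tau>' in at_right \<tau>. walk \<tau>' n \<omega> = walk \<tau> n \<omega>"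
proof -
  let ?z = "follow_arrows (\<lambda>z. \<xi> z \<tau> \<omega>) (0, 0)"
  have z: "?z j \<in> even_lattice" for j
    using \<tau> by (intro follow_arrows_lattice \<xi>_sign \<omega>)
  \<comment> \<open>It suffices to freeze the finitely many clocks along the path drawn at
    \<open>\<tau>\<close>; the path at \<open>\<tau>'\<close> then reads the same arrows.\<close>
  have "\<forall>\<^sub>F \<tau>' in at_right \<tau>. \<forall>j\<in>{..<n}. ring_count (\<lambda>n. gap (?z j) n \<omega>) \<tau>' = ring_count (\<lambda>n. gap (?z j) n \<omega>) \<tau>"
    using ring_count_right_constant[OF fin[OF z] \<tau>(2)] by (intro eventually_ball_finite) auto
  moreover have "\<forall>\<^sub>F \<tau>' in at_right \<tau>. \<tau> < \<tau>'"
    by (simp add: eventually_at_filter)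
  ultimately show ?thesis
  proof eventually_elim
    case (elim \<tau>')
    have "?z n = follow_arrows (\<lambda>z. \<xi> z \<tau>' \<omega>) (0, 0) n"
    proof (rule follow_arrows_cong)
      fix j assume "j < n"
      then show "\<xi> (?z j) \<tau> \<omega> = \<xi> (?z j) \<tau>' \<omega>"
        using elim \<tau> by (simp add: \<xi>_eq[OF z _ \<omega>] site_value_def)
    qed
    then show ?case
      by (simp add: walk_def)
  qed
qed

text \<open>The sets of good dynamical times need not be open, so their interiors are used;
  right-constancy shows that these are still dense. Rational endpoints keep the hypothesis
  \<open>large\<close> a countable family, so that it can hold almost surely.\<close>

lemma exceptional_time_exists:
  assumes \<omega>: "\<omega> \<in> space M" and fin: "\<And>z. z \<in> even_lattice \<Longrightarrow> finite {n. ring_time (\<lambda>n. gap z n \<omega>) n \<le> 1}"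
    and large: "\<And>a b s N. a \<in> \<rat> \<Longrightarrow> b \<in> \<rat> \<Longrightarrow> 0 \<le> a \<Longrightarrow> a < b \<Longrightarrow> b \<le> 1 \<Longrightarrow> s \<in> {-1, 1} \<Longrightarrow>
      \<exists>m\<ge>N. \<exists>\<tau>\<in>{a..<b}. large_at s \<omega> \<tau> m"
  shows "\<exists>\<tau>\<in>{0..1}. \<forall>s\<in>{-1, 1}. \<forall>N. \<exists>m\<ge>N. large_at s \<omega> \<tau> m"
proof -
  define G where "G s N = {0..1} \<inter> interior {\<tau>. \<exists>m\<ge>N. large_at s \<omega> \<tau> m}" for s and N :: nat
  let ?\<G> = "(\<lambda>(s, N). G s N) ` ({-1, 1} \<times> UNIV)"
  have "{0..1} \<subseteq> closure (\<Inter>?\<G>)"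
  proof (rule Baire)
    fix T assume "T \<in> ?\<G>"
    then obtain s N where T: "T = G s N" and s: "s \<in> {-1, 1}"
      by auto
    have "x \<in> closure T" if x: "x \<in> {0..1}" for x
      unfolding closure_approachable
    proof (intro allI impI)
      fix e :: real assume e: "0 < e"
      have "max 0 (x - e) < min 1 (x + e)"
        using x e by auto
      then obtain a where a: "a \<in> \<rat>" "max 0 (x - e) < a" "a < min 1 (x + e)"
        using Rats_dense_in_real by blast
      then obtain b where b: "b \<in> \<rat>" "a < b" "b < min 1 (x + e)"
        using Rats_dense_in_real by blast
      obtain m \<tau> where m: "N \<le> m" and \<tau>: "\<tau> \<in> {a..<b}" and lm: "large_at s \<omega> \<tau> m"
        using large[OF a(1) b(1) _ b(2) _ s, of N] a(2) b(3) by auto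
      have "\<forall>\<^sub>F \<tau>' in at_right \<tau>. walk \<tau>' (m ^ 4) \<omega> = walk \<tau> (m ^ 4) \<omega> \<and> \<tau>' < b"
      proof (rule eventually_conj)
        show "\<forall>\<^sub>F \<tau>' in at_right \<tau>. walk \<tau>' (m ^ 4) \<omega> = walk \<tau> (m ^ 4) \<omega>"
          using \<tau> a(2) b(3) by (intro walk_right_constant \<omega> fin) auto
        show "\<forall>\<^sub>F \<tau>' in at_right \<tau>. \<tau>' < b"
          using \<tau> by (auto simp: eventually_at_right[of \<tau> b] intro!: exI[of _ b])
      qed
      then obtain c where c: "\<tau> < c" "\<And>\<tau>'. \<tau> < \<tau>' \<Longrightarrow> \<tau>' < c \<Longrightarrow> walk \<tau>' (m ^ 4) \<omega> = walk \<tau> (m ^ 4) \<omega> \<and> \<tau>' < b"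
        by (auto simp: eventually_at_right[OF less_add_one])
      \<comment> \<open>The time \<open>\<tau>\<close> itself may be a boundary point, as constancy
        is known only to its right; the midpoint is interior.\<close>
      define y where "y = (\<tau> + c) / 2"
      have y: "y \<in> {\<tau><..<c}"
        using c(1) by (simp add: y_def)
      have "{\<tau><..<c} \<subseteq> {\<tau>. \<exists>m\<ge>N. large_at s \<omega> \<tau> m}"
        using c(2) m lm by (auto simp: large_at_def)
      then have "y \<in> interior {\<tau>. \<exists>m\<ge>N. large_at s \<omega> \<tau> m}"
        using y by (meson interior_maximal open_greaterThanLessThan subsetD)
      moreover have "a < y" "y < b"
        using y c(2)[of y] \<tau> by auto
      ultimately show "\<exists>y\<in>T. dist y x < e"
        using a(2) b(3) by (intro bexI[of _ y]) (auto simp: T G_def dist_real_def)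
    qed
    moreover have "openin (top_of_set {0..1}) T"
      unfolding T G_def by (intro openin_open_Int open_interior)
    ultimately show "openin (top_of_set {0..1}) T \<and> {0..1} \<subseteq> closure T"
      by blast
  qed auto
  then have "\<Inter>?\<G> \<noteq> {}"
    by auto
  then obtain \<tau> where \<tau>: "\<tau> \<in> \<Inter>?\<G>"
    by blast
  show ?thesis
  proof (intro bexI[of _ \<tau>] ballI allI)
    show "\<tau> \<in> {0..1}"
      using \<tau> by (auto simp: G_def)
    show "\<exists>m\<ge>N. large_at s \<omega> \<tau> m" if "s \<in> {-1, 1}" for s N
    proof -
      have "\<tau> \<in> G s N"
        using \<tau> that by blast
      then have "\<tau> \<in> {\<tau>. \<exists>m\<ge>N. large_at s \<omega> \<tau> m}"
        using interior_subset unfolding G_def by blast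
      then show ?thesis
        by blast
    qed
  qed
qed

lemma web_path_at_nat: "web_path (\<lambda>z. \<xi> z \<tau> \<omega>) (0, 0) (real n) = real_of_int (walk \<tau> n \<omega>)"
  by (simp add: web_path_def walk_def Let_def frac_def)

text \<open>It is enough that the normalised path passes the level at arbitrarily large times, and
  the times \<open>m ^ 4\<close> provide these.\<close>

lemma superdiffusive_of_large_at:
  assumes large: "\<And>s N. s \<in> {-1, 1} \<Longrightarrow> \<exists>m\<ge>N. large_at s \<omega> \<tau> m"
  shows "ereal (1 / 10) \<le> Limsup at_top (\<lambda>t::real. ereal (web_path (\<lambda>z. \<xi> z \<tau> \<omega>) (0, 0) t / sqrt (t * ln t)))"
    and "Liminf at_top (\<lambda>t::real. ereal (web_path (\<lambda>z. \<xi> z \<tau> \<omega>) (0, 0) t / sqrt (t * ln t))) \<le> ereal (- (1 / 10))"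
proof -
  let ?f = "\<lambda>t::real. web_path (\<lambda>z. \<xi> z \<tau> \<omega>) (0, 0) t / sqrt (t * ln t)"
  have ex: "\<exists>t\<ge>t0. 1 / 10 \<le> s * ?f t" if s: "s \<in> {-1, 1}" for s t0
  proof -
    \<comment> \<open>The lower bound 2 makes the logarithm positive, so that division by the square
      root is harmless.\<close>
    obtain m where m: "max 2 (nat \<lceil>t0\<rceil>) \<le> m" "large_at s \<omega> \<tau> m"
      using large[OF s] by blast
    have "m ^ 1 \<le> m ^ 4"
      using m(1) by (intro power_increasing) auto
    then have "real m \<le> real (m ^ 4)"
      by (simp only: of_nat_le_iff power_one_right)
    then have t: "t0 \<le> real (m ^ 4)" "1 < real (m ^ 4)"
      using m(1) by linarith+
    then have "0 < sqrt (real (m ^ 4) * ln (real (m ^ 4)))"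
      using t(2) by (intro real_sqrt_gt_zero mult_pos_pos ln_gt_zero) linarith+
    then have "1 / 10 \<le> s * real_of_int (walk \<tau> (m ^ 4) \<omega>) / sqrt (real (m ^ 4) * ln (real (m ^ 4)))"
      using m(2) unfolding large_at_def threshold_def by (subst pos_le_divide_eq)
    then have "1 / 10 \<le> s * ?f (real (m ^ 4))"
      by (simp only: web_path_at_nat times_divide_eq_right)
    then show ?thesis
      using t by blast
  qed
  show "ereal (1 / 10) \<le> Limsup at_top (\<lambda>t. ereal (?f t))"
  proof (rule ccontr)
    assume "\<not> ?thesis"
    then have "\<forall>\<^sub>F t in at_top. ereal (?f t) < ereal (1 / 10)"
      by (intro Limsup_lessD) simp
    then obtain t0 where t0: "\<forall>t\<ge>t0. ?f t < 1 / 10"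
      by (auto simp: eventually_at_top_linorder)
    obtain t where "t0 \<le> t" "1 / 10 \<le> 1 * ?f t"
      using ex[of 1 t0] by blast
    with t0[rule_format, of t] show False
      by linarith
  qed
  show "Liminf at_top (\<lambda>t. ereal (?f t)) \<le> ereal (- (1 / 10))"
  proof (rule ccontr)
    assume "\<not> ?thesis"
    then have "\<forall>\<^sub>F t in at_top. ereal (- (1 / 10)) < ereal (?f t)"
      by (intro less_LiminfD) simp
    then obtain t0 where t0: "\<forall>t\<ge>t0. - (1 / 10) < ?f t"
      by (auto simp: eventually_at_top_linorder)
    obtain t where "t0 \<le> t" "1 / 10 \<le> - 1 * ?f t"
      using ex[of "- 1" t0] by blast
    with t0[rule_format, of t] show False
      by linarith
  qed
qed

text \<open>Rational intervals, signs and bounds \<open>N\<close> form a countable family, so one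
  almost sure event serves all of them; the category argument is then applied to each single
  outcome.\<close>

lemma AE_exceptional_time:
  "AE \<omega> in M. \<exists>\<tau>\<in>{0..1::real}.
     ereal (1 / 10) \<le> Limsup at_top (\<lambda>t::real. ereal (web_path (\<lambda>z. \<xi> z \<tau> \<omega>) (0, 0) t / sqrt (t * ln t))) \<and>
     Liminf at_top (\<lambda>t::real. ereal (web_path (\<lambda>z. \<xi> z \<tau> \<omega>) (0, 0) t / sqrt (t * ln t))) \<le> ereal (- (1 / 10))"
proof -
  let ?P = "{(a, b). a \<in> \<rat> \<and> b \<in> \<rat> \<and> 0 \<le> a \<and> a < b \<and> b \<le> (1::real)}"
  let ?I = "?P \<times> ({-1, 1} :: real set) \<times> (UNIV :: nat set)"
  have "countable ?P"
    by (rule countable_subset[of _ "\<rat> \<times> \<rat>"]) (auto intro: countable_rat)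
  then have "countable ?I"
    by (intro countable_SIGMA) auto
  then have "AE \<omega> in M. \<forall>i\<in>?I. \<exists>m\<ge>snd (snd i). \<exists>\<tau>\<in>{fst (fst i)..<snd (fst i)}. large_at (fst (snd i)) \<omega> \<tau> m"
  proof (subst AE_ball_countable, assumption, intro ballI AE_large_at)
    fix i assume i: "i \<in> ?I"
    then show "fst (snd i) \<in> {-1, 1}"
      by (simp only: mem_Times_iff)
    from i have "fst i \<in> ?P"
      by (simp only: mem_Times_iff)
    then show "0 \<le> fst (fst i)" "fst (fst i) < snd (fst i)" "snd (fst i) \<le> 1"
      by (simp_all add: case_prod_beta)
  qed
  then show ?thesis
    using AE_finite_rings AE_space
  proof eventually_elim
    case (elim \<omega>)
    have "\<exists>\<tau>\<in>{0..1}. \<forall>s\<in>{-1, 1}. \<forall>N. \<exists>m\<ge>N. large_at s \<omega> \<tau> m"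
    proof (rule exceptional_time_exists[OF elim(3)])
      show "finite {n. ring_time (\<lambda>n. gap z n \<omega>) n \<le> 1}" if "z \<in> even_lattice" for z
        using elim(2) that by blast
      show "\<exists>m\<ge>N. \<exists>\<tau>\<in>{a..<b}. large_at s \<omega> \<tau> m"
        if "a \<in> \<rat>" "b \<in> \<rat>" "0 \<le> a" "a < b" "b \<le> 1" "s \<in> {-1, 1}" for a b s N
        using bspec[OF elim(1), of "((a, b), s, N)"] that by auto
    qed
    then obtain \<tau> where \<tau>: "\<tau> \<in> {0..1}" "\<forall>s\<in>{-1, 1}. \<forall>N. \<exists>m\<ge>N. large_at s \<omega> \<tau> m"
      by (elim bexE)
    show ?case
    proof (intro bexI[of _ \<tau>] conjI)
      show "ereal (1 / 10) \<le> Limsup at_top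
          (\<lambda>t::real. ereal (web_path (\<lambda>z. \<xi> z \<tau> \<omega>) (0, 0) t / sqrt (t * ln t)))"
        by (rule superdiffusive_of_large_at(1)) (use \<tau>(2) in blast)
      show "Liminf at_top (\<lambda>t::real. ereal (web_path (\<lambda>z. \<xi> z \<tau> \<omega>) (0, 0) t / sqrt (t * ln t)))
          \<le> ereal (- (1 / 10))"
        by (rule superdiffusive_of_large_at(2)) (use \<tau>(2) in blast)
    qed (rule \<tau>(1))
  qed
qed

end

theorem theorem3:
  shows "\<exists>C0>0. \<forall>C::real. 0 < C \<and> C \<le> C0 \<longrightarrow>
    (\<forall>(M :: 'a measure) gap spin \<xi>. dynamical_web M gap spin \<xi> \<longrightarrow>
      (AE \<omega> in M. \<exists>\<tau>\<in>{0..1::real}.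
         Limsup at_top (\<lambda>t::real. ereal (web_path (\<lambda>z. \<xi> z \<tau> \<omega>) (0, 0) t / sqrt (t * ln t)))
           \<ge> ereal C \<and>
         Liminf at_top (\<lambda>t::real. ereal (web_path (\<lambda>z. \<xi> z \<tau> \<omega>) (0, 0) t / sqrt (t * ln t)))
           \<le> ereal (- C)))"
\<comment> \<open>The witness is the constant of \<open>threshold\<close>; smaller \<open>C\<close>
  only weaken both inequalities.\<close>
proof (intro exI[of _ "1 / 10"] conjI allI impI)
  fix C :: real and M :: "'a measure" and gap spin \<xi>
  assume C: "0 < C \<and> C \<le> 1 / 10" and "dynamical_web M gap spin \<xi>"
  then interpret dynamical_web M gap spin \<xi>
    by simp
  have "ereal C \<le> ereal (1 / 10)" "ereal (- (1 / 10)) \<le> ereal (- C)"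
    using C by simp_all
  with AE_exceptional_time
  show "AE \<omega> in M. \<exists>\<tau>\<in>{0..1::real}.
      Limsup at_top (\<lambda>t::real. ereal (web_path (\<lambda>z. \<xi> z \<tau> \<omega>) (0, 0) t / sqrt (t * ln t))) \<ge> ereal C \<and>
      Liminf at_top (\<lambda>t::real. ereal (web_path (\<lambda>z. \<xi> z \<tau> \<omega>) (0, 0) t / sqrt (t * ln t))) \<le> ereal (- C)"
    by (elim eventually_mono) (blast intro: order_trans)
qed simp

end
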